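(* Let $\Gamma$ be the group of isometries of $\mathbb{R}^2$ consisting of the maps $$(x,y)\mapsto(x+2m,y+2n),\quad (x,y)\mapsto(2m-x,2n-y),\quad (x,y)\mapsto(2m+1-x,2n+1+y),\quad (x,y)\mapsto(2m+1+x,2n+1-y)$$ for $m,n\in\mathbb{Z}$ (the wallpaper group $p2gg$), and let $N\le\Gamma$ be the index two subgroup of orientation-preserving elements (the first two types). Let $F=C_4$, let $H\cong C_2$ be the index two subgroup of $F$, let $G$ be the pullback of $\Gamma\to\Gamma/N\cong C_2$ and $F\to F/H\cong C_2$, and let $p\colon G\to F$ be the projection. Let $G$ act on $\mathbb{R}^2$ through the projection $G\to\Gamma$. Then $\mathbb{R}^2$ is a cocompact model for $\underline{E}G$, every finite subgroup of $G$ is mapped by $p$ into $H$, and, with $\lambda\colon H\to \mathrm{O}(1,\mathbb{R})=C_2$ the $1$-dimensional real sign representation, the compatible collection of real representations $([\lambda\circ p_{|S}])_{S\in\mathcal{F}}$ of the finite subgroups of $G$ cannot be realized as a real $G$-vector bundle over $\mathbb{R}^2$.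
   Context: For a discrete group $G$, $\mathcal{F}$ is the family of finite subgroups of $G$. The orbit category $\mathcal{O}_{\mathcal{F}}G$ has objects $G/S$ with $S\in\mathcal{F}$ and morphisms the $G$-maps. A model for $\underline{E}G$ is a $G$-CW-complex all of whose isotropy groups are finite and such that the fixed point set of every $S\in\mathcal{F}$ is contractible; it is cocompact if its orbit space is compact. A compatible collection of $n$-dimensional real representations of the finite subgroups of $G$ is an element $([\alpha_S])_{S\in\mathcal{F}}$ of $\lim_{G/S\in\mathcal{O}_{\mathcal{F}}G}\mathrm{Hom}(S,\mathrm{O}(n))/\mathrm{Inn}(\mathrm{O}(n))$. A real $G$-vector bundle over a $G$-CW-complex $X$ is a real vector bundle $\pi\colon E\to X$ with a $G$-action on $E$ such that $\pi$ is $G$-equivariant and each $g\in G$ acts by a bundle isomorphism. A compatible collection $([\alpha_S])_{S}$ is realized by a real $G$-vector bundle $E$ over a model $X$ for $\underline{E}G$ if for every $S\in\mathcal{F}$ and $x\in X^S$ the $S$-representation on the fiber $E_x$ is isomorphic to $\alpha_S$. *)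

theory Defs
  imports "HOL-Analysis.Analysis" "HOL-Algebra.Group_Action" "HOL-Algebra.Left_Coset" "HOL-Algebra.Elementary_Groups"
begin

section \<open>Spaces with an action of a discrete group\<close>

definition G_space :: "('g, 'm) monoid_scheme \<Rightarrow> 'x topology \<Rightarrow> ('g \<Rightarrow> 'x \<Rightarrow> 'x) \<Rightarrow> bool" where
  "G_space G X \<phi> \<longleftrightarrow>
     group_action G (topspace X) \<phi> \<and> (\<forall>g\<in>carrier G. continuous_map X X (\<phi> g))"

definition fixed_points :: "'x topology \<Rightarrow> ('g \<Rightarrow> 'x \<Rightarrow> 'x) \<Rightarrow> 'g set \<Rightarrow> 'x set" where
  "fixed_points X \<phi> S = {x \<in> topspace X. \<forall>s\<in>S. \<phi> s x = x}"

definition orbit_space ::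
    "('g, 'm) monoid_scheme \<Rightarrow> 'x topology \<Rightarrow> ('g \<Rightarrow> 'x \<Rightarrow> 'x) \<Rightarrow> 'x set topology" where
  "orbit_space G X \<phi> = topology (\<lambda>V. V \<subseteq> orbits G (topspace X) \<phi> \<and>
     openin X {x \<in> topspace X. orbit G \<phi> x \<in> V})"

lemma openin_orbit_space:
  "openin (orbit_space G X \<phi>) V \<longleftrightarrow> V \<subseteq> orbits G (topspace X) \<phi> \<and>
     openin X {x \<in> topspace X. orbit G \<phi> x \<in> V}"
proof -
  let ?P = "\<lambda>V. V \<subseteq> orbits G (topspace X) \<phi> \<and> openin X {x \<in> topspace X. orbit G \<phi> x \<in> V}"
  have "istopology ?P"
    unfolding istopology_def
  proof (intro conjI allI impI)
    fix S T assume S: "?P S" and T: "?P T"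
    show "S \<inter> T \<subseteq> orbits G (topspace X) \<phi>" using S by blast
    have "{x \<in> topspace X. orbit G \<phi> x \<in> S \<inter> T} =
        {x \<in> topspace X. orbit G \<phi> x \<in> S} \<inter> {x \<in> topspace X. orbit G \<phi> x \<in> T}" by blast
    then show "openin X {x \<in> topspace X. orbit G \<phi> x \<in> S \<inter> T}"
      using S T by (simp add: openin_Int)
  next
    fix \<K> assume K: "\<forall>K\<in>\<K>. ?P K"
    then show "\<Union>\<K> \<subseteq> orbits G (topspace X) \<phi>" by blast
    have "{x \<in> topspace X. orbit G \<phi> x \<in> \<Union>\<K>} = (\<Union>K\<in>\<K>. {x \<in> topspace X. orbit G \<phi> x \<in> K})"
      by blast
    then show "openin X {x \<in> topspace X. orbit G \<phi> x \<in> \<Union>\<K>}"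
      using K by (auto intro: openin_Union simp del: Union_iff)
  qed
  then show ?thesis by (simp add: orbit_space_def)
qed


section \<open>G-CW-complexes\<close>

definition disk :: "nat \<Rightarrow> (nat \<Rightarrow> real) topology" where
  "disk n = subtopology (Euclidean_space n) {v. (\<Sum>i<n. v i ^ 2) \<le> 1}"

definition disk_boundary :: "nat \<Rightarrow> (nat \<Rightarrow> real) set" where
  "disk_boundary n = {v \<in> topspace (disk n). (\<Sum>i<n. v i ^ 2) = 1}"

definition orbit_cell ::
    "('g, 'm) monoid_scheme \<Rightarrow> 'g set \<Rightarrow> nat \<Rightarrow> ('g set \<times> (nat \<Rightarrow> real)) topology" where
  "orbit_cell G H n = prod_topology (discrete_topology (lcosets\<^bsub>G\<^esub> H)) (disk n)"

text \<open>
  A family of equivariant \<open>n\<close>-cells is a set \<open>C\<close> of pairs \<open>(H, \<Phi>)\<close>, where \<open>\<Phi>\<close> is the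
  characteristic map \<open>G/H \<times> D\<^sup>n \<rightarrow> B\<close> (distinct cells have distinct characteristic maps, so no
  separate index set is needed). The predicate says that \<open>B\<close> is the pushout of
  \<open>A \<leftarrow> \<Coprod> G/H \<times> S\<^sup>n\<^sup>-\<^sup>1 \<rightarrow> \<Coprod> G/H \<times> D\<^sup>n\<close>: the last two conjuncts are the
  pushout property for the underlying sets and for the topology (the final topology, which
  also gives the continuity of the characteristic maps).
\<close>

definition attaches_orbit_cells ::
    "('g, 'm) monoid_scheme \<Rightarrow> 'x topology \<Rightarrow> ('g \<Rightarrow> 'x \<Rightarrow> 'x) \<Rightarrow> nat \<Rightarrow> 'x set \<Rightarrow> 'x set \<Rightarrow>
      ('g set \<times> ('g set \<times> (nat \<Rightarrow> real) \<Rightarrow> 'x)) set \<Rightarrow> bool" where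
  "attaches_orbit_cells G X \<phi> n A B C \<longleftrightarrow>
     A \<subseteq> B \<and>
     (\<forall>(H, \<Phi>)\<in>C. subgroup H G \<and>
        \<Phi> ` topspace (orbit_cell G H n) \<subseteq> B \<and>
        \<Phi> ` ((lcosets\<^bsub>G\<^esub> H) \<times> disk_boundary n) \<subseteq> A \<and>
        (\<forall>g\<in>carrier G. \<forall>c\<in>lcosets\<^bsub>G\<^esub> H. \<forall>v\<in>topspace (disk n).
           \<Phi> (g <#\<^bsub>G\<^esub> c, v) = \<phi> g (\<Phi> (c, v)))) \<and>
     bij_betw (\<lambda>((H, \<Phi>), p). \<Phi> p)
       (SIGMA (H, \<Phi>):C. (lcosets\<^bsub>G\<^esub> H) \<times> (topspace (disk n) - disk_boundary n)) (B - A) \<and>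
     (\<forall>U\<subseteq>B. openin (subtopology X B) U \<longleftrightarrow>
        openin (subtopology X A) (U \<inter> A) \<and>
        (\<forall>(H, \<Phi>)\<in>C. openin (orbit_cell G H n) {p \<in> topspace (orbit_cell G H n). \<Phi> p \<in> U}))"

text \<open>Here \<open>Sk n\<close> is the skeleton of dimension \<open>n - 1\<close>.\<close>

definition G_CW_complex ::
    "('g, 'm) monoid_scheme \<Rightarrow> 'x topology \<Rightarrow> ('g \<Rightarrow> 'x \<Rightarrow> 'x) \<Rightarrow> bool" where
  "G_CW_complex G X \<phi> \<longleftrightarrow> G_space G X \<phi> \<and>
     (\<exists>Sk C. Sk 0 = {} \<and> (\<Union>n. Sk n) = topspace X \<and>
        (\<forall>n. attaches_orbit_cells G X \<phi> n (Sk n) (Sk (Suc n)) (C n)) \<and>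
        (\<forall>U\<subseteq>topspace X. openin X U \<longleftrightarrow> (\<forall>n. openin (subtopology X (Sk n)) (U \<inter> Sk n))))"


section \<open>Classifying spaces for proper actions\<close>

definition finite_subgroups :: "('g, 'm) monoid_scheme \<Rightarrow> 'g set set" where
  "finite_subgroups G = {S. subgroup S G \<and> finite S}"

text \<open>\<^const>\<open>contractible_space\<close> holds of the empty space, hence the nonemptiness condition.\<close>

definition model_for_EG ::
    "('g, 'm) monoid_scheme \<Rightarrow> 'x topology \<Rightarrow> ('g \<Rightarrow> 'x \<Rightarrow> 'x) \<Rightarrow> bool" where
  "model_for_EG G X \<phi> \<longleftrightarrow> G_CW_complex G X \<phi> \<and>
     (\<forall>x\<in>topspace X. finite (stabilizer G \<phi> x)) \<and>
     (\<forall>S\<in>finite_subgroups G. fixed_points X \<phi> S \<noteq> {} \<and>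
        contractible_space (subtopology X (fixed_points X \<phi> S)))"

definition cocompact_model_for_EG ::
    "('g, 'm) monoid_scheme \<Rightarrow> 'x topology \<Rightarrow> ('g \<Rightarrow> 'x \<Rightarrow> 'x) \<Rightarrow> bool" where
  "cocompact_model_for_EG G X \<phi> \<longleftrightarrow>
     model_for_EG G X \<phi> \<and> compact_space (orbit_space G X \<phi>)"


section \<open>Compatible collections of representations\<close>

definition orthogonal_grp :: "(real^'n^'n) monoid" where
  "orthogonal_grp = \<lparr>carrier = {A. orthogonal_matrix A}, mult = (**), one = mat 1\<rparr>"

definition Hom_from_subgroup ::
    "('g, 'm) monoid_scheme \<Rightarrow> 'g set \<Rightarrow> ('k, 'l) monoid_scheme \<Rightarrow> ('g \<Rightarrow> 'k) set" where
  "Hom_from_subgroup G S K = hom (G\<lparr>carrier := S\<rparr>) K \<inter> extensional S"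

definition inner_conj_rel ::
    "('g, 'm) monoid_scheme \<Rightarrow> 'g set \<Rightarrow> ('k, 'l) monoid_scheme \<Rightarrow> (('g \<Rightarrow> 'k) \<times> ('g \<Rightarrow> 'k)) set" where
  "inner_conj_rel G S K = {(\<alpha>, \<beta>). \<alpha> \<in> Hom_from_subgroup G S K \<and> \<beta> \<in> Hom_from_subgroup G S K \<and>
     (\<exists>k\<in>carrier K. \<forall>s\<in>S. \<beta> s = k \<otimes>\<^bsub>K\<^esub> \<alpha> s \<otimes>\<^bsub>K\<^esub> inv\<^bsub>K\<^esub> k)}"

text \<open>Morphisms \<open>G/S \<rightarrow> G/T\<close> of the orbit category.\<close>

definition G_maps :: "('g, 'm) monoid_scheme \<Rightarrow> 'g set \<Rightarrow> 'g set \<Rightarrow> ('g set \<Rightarrow> 'g set) set" where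
  "G_maps G S T = {f \<in> lcosets\<^bsub>G\<^esub> S \<rightarrow>\<^sub>E lcosets\<^bsub>G\<^esub> T.
     \<forall>g\<in>carrier G. \<forall>c\<in>lcosets\<^bsub>G\<^esub> S. f (g <#\<^bsub>G\<^esub> c) = g <#\<^bsub>G\<^esub> f c}"

text \<open>
  The limit over the orbit category of \<open>Hom(S, K)/Inn(K)\<close>. A \<open>G\<close>-map \<open>f\<close> with
  \<open>f S = g T\<close> satisfies \<open>g\<inverse> S g \<subseteq> T\<close> and sends the class of \<open>\<alpha>\<close> to that of
  \<open>s \<mapsto> \<alpha> (g\<inverse> s g)\<close>; the latter depends neither on \<open>g\<close> nor on the representative \<open>\<alpha>\<close>.
\<close>

definition compatible_collections ::
    "('g, 'm) monoid_scheme \<Rightarrow> ('k, 'l) monoid_scheme \<Rightarrow> ('g set \<Rightarrow> ('g \<Rightarrow> 'k) set) set" where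
  "compatible_collections G K =
     {A \<in> (\<Pi>\<^sub>E S\<in>finite_subgroups G. Hom_from_subgroup G S K // inner_conj_rel G S K).
       \<forall>S\<in>finite_subgroups G. \<forall>T\<in>finite_subgroups G. \<forall>f\<in>G_maps G S T.
         \<forall>\<alpha>\<in>A T. \<forall>g\<in>carrier G. f S = g <#\<^bsub>G\<^esub> T \<longrightarrow>
           (\<lambda>s\<in>S. \<alpha> (inv\<^bsub>G\<^esub> g \<otimes>\<^bsub>G\<^esub> s \<otimes>\<^bsub>G\<^esub> g)) \<in> A S}"


section \<open>Equivariant real vector bundles\<close>

record ('e, 'x) vbundle =
  total :: "'e topology"
  proj :: "'e \<Rightarrow> 'x"
  fadd :: "'e \<Rightarrow> 'e \<Rightarrow> 'e"
  fscale :: "real \<Rightarrow> 'e \<Rightarrow> 'e"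

definition fibre :: "('e, 'x) vbundle \<Rightarrow> 'x \<Rightarrow> 'e set" where
  "fibre E x = {e \<in> topspace (total E). proj E e = x}"

text \<open>
  The operations \<open>fadd\<close> and \<open>fscale\<close> matter only within fibres. That they make every
  fibre a finite-dimensional vector space follows from the fibrewise linearity of the
  local trivializations \<open>h\<close>, which identify each fibre with some \<open>\<real>\<^sup>k\<close>.
\<close>

definition real_vector_bundle :: "'x topology \<Rightarrow> ('e, 'x) vbundle \<Rightarrow> bool" where
  "real_vector_bundle X E \<longleftrightarrow>
     continuous_map (total E) X (proj E) \<and>
     (\<forall>x\<in>topspace X. \<exists>U k h. openin X U \<and> x \<in> U \<and>
        homeomorphic_map (prod_topology (subtopology X U) (Euclidean_space k))
          (subtopology (total E) {e \<in> topspace (total E). proj E e \<in> U}) h \<and>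
        (\<forall>y\<in>U. \<forall>v\<in>topspace (Euclidean_space k).
           proj E (h (y, v)) = y \<and>
           (\<forall>w\<in>topspace (Euclidean_space k).
              h (y, \<lambda>i. v i + w i) = fadd E (h (y, v)) (h (y, w))) \<and>
           (\<forall>c. h (y, \<lambda>i. c * v i) = fscale E c (h (y, v)))))"

definition G_vector_bundle ::
    "('g, 'm) monoid_scheme \<Rightarrow> 'x topology \<Rightarrow> ('g \<Rightarrow> 'x \<Rightarrow> 'x) \<Rightarrow>
      ('e, 'x) vbundle \<Rightarrow> ('g \<Rightarrow> 'e \<Rightarrow> 'e) \<Rightarrow> bool" where
  "G_vector_bundle G X \<phi> E \<psi> \<longleftrightarrow>
     real_vector_bundle X E \<and> group_action G (topspace (total E)) \<psi> \<and>
     (\<forall>g\<in>carrier G. homeomorphic_map (total E) (total E) (\<psi> g) \<and>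
        (\<forall>x\<in>topspace X. \<forall>e\<in>fibre E x.
           proj E (\<psi> g e) = \<phi> g x \<and>
           (\<forall>e'\<in>fibre E x. \<psi> g (fadd E e e') = fadd E (\<psi> g e) (\<psi> g e')) \<and>
           (\<forall>c. \<psi> g (fscale E c e) = fscale E c (\<psi> g e))))"

definition fibre_rep_iso ::
    "'g set \<Rightarrow> ('g \<Rightarrow> real^'n^'n) \<Rightarrow> ('e, 'x) vbundle \<Rightarrow> ('g \<Rightarrow> 'e \<Rightarrow> 'e) \<Rightarrow> 'x \<Rightarrow> bool" where
  "fibre_rep_iso S \<alpha> E \<psi> x \<longleftrightarrow>
     (\<exists>L :: real^'n \<Rightarrow> 'e. bij_betw L UNIV (fibre E x) \<and>
        (\<forall>v w. L (v + w) = fadd E (L v) (L w)) \<and>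
        (\<forall>c v. L (c *\<^sub>R v) = fscale E c (L v)) \<and>
        (\<forall>s\<in>S. \<forall>v. L (\<alpha> s *v v) = \<psi> s (L v)))"

definition realizes ::
    "('g, 'm) monoid_scheme \<Rightarrow> 'x topology \<Rightarrow> ('g \<Rightarrow> 'x \<Rightarrow> 'x) \<Rightarrow>
      ('e, 'x) vbundle \<Rightarrow> ('g \<Rightarrow> 'e \<Rightarrow> 'e) \<Rightarrow> ('g set \<Rightarrow> ('g \<Rightarrow> real^'n^'n) set) \<Rightarrow> bool" where
  "realizes G X \<phi> E \<psi> A \<longleftrightarrow> G_vector_bundle G X \<phi> E \<psi> \<and>
     (\<forall>S\<in>finite_subgroups G. \<forall>x\<in>fixed_points X \<phi> S. \<exists>\<alpha>\<in>A S. fibre_rep_iso S \<alpha> E \<psi> x)"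


section \<open>The groups of the example\<close>

definition p2gg_N :: "(real \<times> real \<Rightarrow> real \<times> real) set" where
  "p2gg_N =
     {\<lambda>(x, y). (x + 2 * of_int m, y + 2 * of_int n) | m n :: int. True} \<union>
     {\<lambda>(x, y). (2 * of_int m - x, 2 * of_int n - y) | m n :: int. True}"

definition p2gg :: "(real \<times> real \<Rightarrow> real \<times> real) monoid" where
  "p2gg = \<lparr>carrier = p2gg_N \<union>
     {\<lambda>(x, y). (2 * of_int m + 1 - x, 2 * of_int n + 1 + y) | m n :: int. True} \<union>
     {\<lambda>(x, y). (2 * of_int m + 1 + x, 2 * of_int n + 1 - y) | m n :: int. True},
     mult = (\<circ>), one = id\<rparr>"

abbreviation C2 :: "int monoid" where "C2 \<equiv> integer_mod_group 2"
abbreviation C4 :: "int monoid" where "C4 \<equiv> integer_mod_group 4"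

definition C4_H :: "int set" where "C4_H = {0, 2}"

definition pullback_group ::
    "('a, 'm) monoid_scheme \<Rightarrow> ('b, 'l) monoid_scheme \<Rightarrow> ('a \<Rightarrow> 'c) \<Rightarrow> ('b \<Rightarrow> 'c) \<Rightarrow> ('a \<times> 'b) monoid" where
  "pullback_group A B f g =
     (A \<times>\<times> B)\<lparr>carrier := {(a, b) \<in> carrier A \<times> carrier B. f a = g b}\<rparr>"

definition sign_rep :: "int \<Rightarrow> real^1^1" where
  "sign_rep h = (if h = 0 then mat 1 else - mat 1)"


text \<open>
  The quotients of \<open>p2gg\<close> and \<open>C4\<close> are indeed isomorphic to \<open>C2\<close>, so that
  assumptions choosing such isomorphisms can be satisfied.
\<close>

definition sgn_affine :: "real \<times> real \<times> int \<times> int \<Rightarrow> real \<times> real \<Rightarrow> real \<times> real" where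
  "sgn_affine = (\<lambda>(s, t, a, b) (x, y). (s * x + of_int a, t * y + of_int b))"

definition sgn_affine_par :: "(real \<times> real \<times> int \<times> int) set" where
  "sgn_affine_par = {(s, t, a, b). s \<in> {1, -1} \<and> t \<in> {1, -1} \<and>
     (even a \<longleftrightarrow> s = t) \<and> (even b \<longleftrightarrow> s = t)}"

lemma sgn_affine_inject: "sgn_affine u = sgn_affine v \<longleftrightarrow> u = v"
proof
  assume eq: "sgn_affine u = sgn_affine v"
  obtain s t a b s' t' a' b' where uv: "u = (s, t, a, b)" "v = (s', t', a', b')"
    by (metis prod_cases4)
  have "sgn_affine u (0, 0) = sgn_affine v (0, 0)" "sgn_affine u (1, 1) = sgn_affine v (1, 1)"
    using eq by simp_all
  then show "u = v" by (auto simp: uv sgn_affine_def)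
qed simp

lemma p2gg_N_eq:
  "p2gg_N = {sgn_affine (1, 1, 2 * m, 2 * n) | m n. True} \<union>
     {sgn_affine (-1, -1, 2 * m, 2 * n) | m n. True}"
  by (simp add: p2gg_N_def sgn_affine_def)

lemma carrier_p2gg_eq:
  "carrier p2gg = p2gg_N \<union> {sgn_affine (-1, 1, 2 * m + 1, 2 * n + 1) | m n. True} \<union>
     {sgn_affine (1, -1, 2 * m + 1, 2 * n + 1) | m n. True}"
  by (simp add: p2gg_def sgn_affine_def algebra_simps)

lemma p2gg_N_sgn_affine: "p2gg_N = sgn_affine ` {(s, t, a, b) \<in> sgn_affine_par. s = t}"
  (is "_ = sgn_affine ` ?P")
proof (intro equalityI subsetI)
  fix f assume "f \<in> p2gg_N"
  then obtain u where "f = sgn_affine u" "u \<in> ?P"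
    unfolding p2gg_N_eq sgn_affine_par_def by fastforce
  then show "f \<in> sgn_affine ` ?P" by blast
next
  fix f assume "f \<in> sgn_affine ` ?P"
  then obtain s a b where f: "f = sgn_affine (s, s, a, b)" and s: "s = 1 \<or> s = -1"
      and "even a" "even b"
    unfolding sgn_affine_par_def by fastforce
  then obtain m n where "a = 2 * m" "b = 2 * n" by (meson evenE)
  then show "f \<in> p2gg_N"
    unfolding p2gg_N_eq using f s by blast
qed

lemma carrier_p2gg: "carrier p2gg = sgn_affine ` sgn_affine_par"
proof (intro equalityI subsetI)
  fix f assume "f \<in> carrier p2gg"
  then consider "f \<in> p2gg_N"
    | m n :: int where "f = sgn_affine (-1, 1, 2 * m + 1, 2 * n + 1)"
    | m n :: int where "f = sgn_affine (1, -1, 2 * m + 1, 2 * n + 1)"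
    unfolding carrier_p2gg_eq by blast
  then show "f \<in> sgn_affine ` sgn_affine_par"
  proof cases
    case 1
    then show ?thesis unfolding p2gg_N_sgn_affine by blast
  qed (simp_all add: image_iff sgn_affine_inject sgn_affine_par_def)
next
  fix f assume "f \<in> sgn_affine ` sgn_affine_par"
  then obtain s t a b where f: "f = sgn_affine (s, t, a, b)" and p: "(s, t, a, b) \<in> sgn_affine_par"
    by (metis imageE prod_cases4)
  show "f \<in> carrier p2gg"
  proof (cases "s = t")
    case True
    then have "f \<in> p2gg_N" unfolding p2gg_N_sgn_affine using f p by blast
    then show ?thesis unfolding carrier_p2gg_eq by blast
  next
    case False
    then have "odd a" "odd b" and st: "s = -1 \<and> t = 1 \<or> s = 1 \<and> t = -1"
      using p by (auto simp: sgn_affine_par_def)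
    then obtain m n where "a = 2 * m + 1" "b = 2 * n + 1" by (meson oddE)
    then show ?thesis
      unfolding carrier_p2gg_eq using f st by blast
  qed
qed

lemma sgn_affine_comp:
  assumes "u \<in> sgn_affine_par" "v \<in> sgn_affine_par"
  obtains w where "w \<in> sgn_affine_par" "sgn_affine u \<circ> sgn_affine v = sgn_affine w"
    "fst w = fst u * fst v" "fst (snd w) = fst (snd u) * fst (snd v)"
proof -
  obtain s t a b s' t' a' b' where uv: "u = (s, t, a, b)" "v = (s', t', a', b')"
    by (metis prod_cases4)
  let ?i = "\<lambda>r::real. if r = 1 then 1 else - 1 :: int"
  let ?w = "(s * s', t * t', ?i s * a' + a, ?i t * b' + b)"
  show thesis
  proof
    show "?w \<in> sgn_affine_par"
      using assms by (auto simp: uv sgn_affine_par_def)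
    show "sgn_affine u \<circ> sgn_affine v = sgn_affine ?w"
      using assms by (auto simp: uv sgn_affine_par_def sgn_affine_def fun_eq_iff algebra_simps)
  qed (simp_all add: uv)
qed

lemma p2gg_mult: "f \<otimes>\<^bsub>p2gg\<^esub> g = f \<circ> g" and p2gg_one: "\<one>\<^bsub>p2gg\<^esub> = id"
  by (simp_all add: p2gg_def)

lemma group_p2gg: "group p2gg"
proof (rule groupI)
  fix f g assume "f \<in> carrier p2gg" "g \<in> carrier p2gg"
  then obtain u v where uv: "f = sgn_affine u" "g = sgn_affine v"
      "u \<in> sgn_affine_par" "v \<in> sgn_affine_par"
    unfolding carrier_p2gg by blast
  then obtain w where "w \<in> sgn_affine_par" "sgn_affine u \<circ> sgn_affine v = sgn_affine w"
    using sgn_affine_comp by blast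
  then show "f \<otimes>\<^bsub>p2gg\<^esub> g \<in> carrier p2gg"
    unfolding carrier_p2gg p2gg_mult uv by blast
next
  have "id = sgn_affine (1, 1, 0, 0)" by (rule ext) (auto simp: sgn_affine_def)
  moreover have "(1, 1, 0, 0) \<in> sgn_affine_par" by (simp add: sgn_affine_par_def)
  ultimately show "\<one>\<^bsub>p2gg\<^esub> \<in> carrier p2gg"
    unfolding carrier_p2gg p2gg_one by blast
next
  fix f assume "f \<in> carrier p2gg"
  then obtain s t a b where f: "f = sgn_affine (s, t, a, b)" and p: "(s, t, a, b) \<in> sgn_affine_par"
    unfolding carrier_p2gg by (metis imageE prod_cases4)
  let ?i = "\<lambda>r::real. if r = 1 then 1 else - 1 :: int"
  let ?v = "(s, t, - ?i s * a, - ?i t * b)"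
  have "?v \<in> sgn_affine_par" using p by (auto simp: sgn_affine_par_def)
  moreover have "sgn_affine ?v \<circ> f = id"
  proof (rule ext)
    have "s = 1 \<or> s = -1" "t = 1 \<or> t = -1" using p by (auto simp: sgn_affine_par_def)
    then show "(sgn_affine ?v \<circ> f) z = id z" for z
      by (elim disjE) (simp_all add: f sgn_affine_def split: prod.splits)
  qed
  ultimately show "\<exists>g\<in>carrier p2gg. g \<otimes>\<^bsub>p2gg\<^esub> f = \<one>\<^bsub>p2gg\<^esub>"
    unfolding carrier_p2gg p2gg_one p2gg_mult by blast
qed (simp_all add: p2gg_mult p2gg_one comp_assoc)

lemma p2gg_Mod_N_iso_C2: "p2gg Mod p2gg_N \<cong> C2"
proof -
  define h :: "(real \<times> real \<Rightarrow> real \<times> real) \<Rightarrow> int" where "h = (\<lambda>f. if f \<in> p2gg_N then 0 else 1)"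
  have N: "h (sgn_affine u) = (if fst u = fst (snd u) then 0 else 1)" if "u \<in> sgn_affine_par" for u
    using that unfolding h_def p2gg_N_sgn_affine image_iff sgn_affine_inject
    by (cases u) simp
  have C2: "carrier C2 = {0, 1}" by (auto simp: carrier_integer_mod_group)
  have "h \<in> hom p2gg C2"
  proof (rule homI)
    show "h f \<in> carrier C2" for f by (simp add: C2 h_def)
    fix f g assume "f \<in> carrier p2gg" "g \<in> carrier p2gg"
    then obtain u v where uv: "f = sgn_affine u" "g = sgn_affine v"
        "u \<in> sgn_affine_par" "v \<in> sgn_affine_par"
      unfolding carrier_p2gg by blast
    obtain w where w: "w \<in> sgn_affine_par" "sgn_affine u \<circ> sgn_affine v = sgn_affine w"
        "fst w = fst u * fst v" "fst (snd w) = fst (snd u) * fst (snd v)"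
      using sgn_affine_comp uv(3,4) by blast
    have "fst u = 1 \<or> fst u = -1" "fst (snd u) = 1 \<or> fst (snd u) = -1"
        "fst v = 1 \<or> fst v = -1" "fst (snd v) = 1 \<or> fst (snd v) = -1"
      using uv(3,4) by (auto simp: sgn_affine_par_def)
    then show "h (f \<otimes>\<^bsub>p2gg\<^esub> g) = h f \<otimes>\<^bsub>C2\<^esub> h g"
      unfolding p2gg_mult uv(1,2) w(2) N[OF uv(3)] N[OF uv(4)] N[OF w(1)] w(3,4)
      by (elim disjE) simp_all
  qed
  then interpret h: group_hom p2gg C2 h
    by (simp add: group_hom_def group_hom_axioms_def group_p2gg)
  have par: "(-1, 1, 1, 1) \<in> sgn_affine_par" by (simp add: sgn_affine_par_def)
  have "h (sgn_affine (-1, 1, 1, 1)) = 1" using N[OF par] by simp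
  moreover have "sgn_affine (-1, 1, 1, 1) \<in> carrier p2gg"
    unfolding carrier_p2gg using par by blast
  ultimately have "1 \<in> h ` carrier p2gg" by (metis image_eqI)
  moreover have "0 \<in> h ` carrier p2gg"
    using imageI[OF h.G.one_closed, of h] by simp
  moreover have "h ` carrier p2gg \<subseteq> carrier C2" using h.hom_closed by blast
  ultimately have "h ` carrier p2gg = carrier C2" unfolding C2 by blast
  moreover have "kernel p2gg C2 h = p2gg_N"
  proof -
    have "p2gg_N \<subseteq> carrier p2gg" unfolding carrier_p2gg_eq by blast
    then show ?thesis unfolding kernel_def h_def by auto
  qed
  ultimately show ?thesis using h.FactGroup_iso by simp
qed

lemma C4_Mod_H_iso_C2: "C4 Mod C4_H \<cong> C2"
proof -
  let ?h = "\<lambda>x::int. x mod 2"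
  have "?h \<in> hom C4 C2"
  proof (rule homI)
    fix x y assume "x \<in> carrier C4" "y \<in> carrier C4"
    then show "?h (x \<otimes>\<^bsub>C4\<^esub> y) = ?h x \<otimes>\<^bsub>C2\<^esub> ?h y"
      by (simp add: mod_mod_cancel mod_add_eq)
  qed (auto simp: carrier_integer_mod_group)
  then interpret h: group_hom C4 C2 ?h
    by (simp add: group_hom_def group_hom_axioms_def)
  have 4: "carrier C4 = {0, 1, 2, 3}" and 2: "carrier C2 = {0, 1}"
    by (auto simp: carrier_integer_mod_group)
  have "?h ` carrier C4 = carrier C2" unfolding 4 2 by auto
  moreover have "kernel C4 C2 ?h = C4_H"
    unfolding kernel_def C4_H_def 4 by auto
  ultimately show ?thesis using h.FactGroup_iso by simp
qed

end

theory Submission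
  imports Defs
begin

text \<open>
  The unit squares with integer vertices form a \<open>G\<close>-CW-structure on the plane with two orbits of
  vertices, two of edges and one of squares. A finite subgroup acts by affine maps, so it fixes the
  centroid of an orbit; its fixed point set is convex, and it contains no glide reflections, since
  these have no fixed points.

  A bundle realizing the collection would be a line bundle, hence orientable over every box. Then
  every \<open>g\<close> either preserves or reverses the orientation, and this sign is constant along the box.
  The glide reflection \<open>g\<close> in the line \<open>x = 1/2\<close> maps \<open>(0, 0)\<close> to \<open>(1, 1)\<close> and that to \<open>(0, 2)\<close>,
  so its square has sign \<open>1\<close>. But the square is also the product of two rotations by a half turn,
  which have sign \<open>1\<close> because they do at their fixed points, and of the central element \<open>(id, 2)\<close>,
  which has sign \<open>- 1\<close>.
\<close>

section \<open>The group\<close>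

text \<open>The obstruction comes from C4 being a nonsplit extension: the sign representation of its
  subgroup of order two extends to C4 over the complex numbers, but not over the reals, where no
  number squares to - 1. Finite subgroups never see this, so the contradiction appears only when a
  bundle relates fibres over different points. That comparison needs continuity, whereas nonzero
  vectors picked fibre by fibre need not vary continuously. Hence only signs of scalars are kept,
  and a sign function on a compact box corrects the arbitrary choices. An element \<open>g\<close>
  can then be compared with the orientation only along connected sets that lie in the box together
  with their image under \<open>g\<close>.\<close>

lemma iso_C2_rcos:
  assumes "group A" and N: "subgroup N A" and \<iota>: "\<iota> \<in> iso (A Mod N) C2" and f: "f \<in> carrier A"
  shows "\<iota> (N #>\<^bsub>A\<^esub> f) = (if f \<in> N then 0 else 1)"
proof -
  interpret A: group A by fact
  have C2: "carrier C2 = {0, 1}" by (auto simp: carrier_integer_mod_group)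
  have car: "N #>\<^bsub>A\<^esub> h \<in> carrier (A Mod N)" if "h \<in> carrier A" for h
    using that by (auto simp: FactGroup_def RCOSETS_def)
  have N1: "N #>\<^bsub>A\<^esub> \<one>\<^bsub>A\<^esub> = N" using N by (simp add: A.coset_mult_one subgroup.subset)
  have Nc: "N \<in> carrier (A Mod N)" using car[OF A.one_closed] N1 by simp
  \<comment> \<open>\<open>N\<close> is the identity of the quotient, and 0 is the only element of
    C2 equal to its own double.\<close>
  have "\<iota> (N \<otimes>\<^bsub>A Mod N\<^esub> N) = \<iota> N \<otimes>\<^bsub>C2\<^esub> \<iota> N"
    using \<iota> Nc by (simp add: iso_def hom_def)
  moreover have "N \<otimes>\<^bsub>A Mod N\<^esub> N = N"
    using A.subgroup_mult_id[OF N] by (simp add: FactGroup_def)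
  moreover have \<iota>r: "\<iota> X \<in> {0, 1}" if "X \<in> carrier (A Mod N)" for X
    using \<iota> that C2 by (auto simp: iso_def hom_def)
  ultimately have 0: "\<iota> N = 0" using \<iota>r[OF Nc] by auto
  show ?thesis
  proof (cases "f \<in> N")
    case True
    then show ?thesis using 0 A.coset_join2[OF f N] by simp
  next
    case False
    then have "N #>\<^bsub>A\<^esub> f \<noteq> N" using A.rcos_self[OF f N] by auto
    moreover have "inj_on \<iota> (carrier (A Mod N))" using \<iota> by (simp add: iso_def bij_betw_def)
    ultimately have "\<iota> (N #>\<^bsub>A\<^esub> f) \<noteq> 0"
      using 0 Nc car[OF f] by (metis inj_on_eq_iff)
    then show ?thesis using \<iota>r[OF car[OF f]] False by auto
  qed
qed

lemma carrier_C4: "carrier C4 = {0, 1, 2, 3}"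
  by (auto simp: carrier_integer_mod_group)

lemma sgn_affine_in_N_iff:
  "(s, t, a, b) \<in> sgn_affine_par \<Longrightarrow> sgn_affine (s, t, a, b) \<in> p2gg_N \<longleftrightarrow> s = t"
  unfolding p2gg_N_sgn_affine image_iff by (auto simp: sgn_affine_inject)

lemma p2gg_N_subset: "p2gg_N \<subseteq> carrier p2gg"
  unfolding carrier_p2gg_eq by blast

text \<open>Membership in \<open>p2gg_N\<close> means that the two diagonal signs agree, that is,
  that the determinant is 1, and determinants multiply.\<close>

lemma p2gg_comp_in_N_iff:
  assumes "f \<in> carrier p2gg" "g \<in> carrier p2gg"
  shows "f \<circ> g \<in> p2gg_N \<longleftrightarrow> (f \<in> p2gg_N \<longleftrightarrow> g \<in> p2gg_N)"
proof -
  obtain u v where uv: "f = sgn_affine u" "g = sgn_affine v"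
      "u \<in> sgn_affine_par" "v \<in> sgn_affine_par"
    using assms unfolding carrier_p2gg by blast
  obtain w where w: "w \<in> sgn_affine_par" "sgn_affine u \<circ> sgn_affine v = sgn_affine w"
      "fst w = fst u * fst v" "fst (snd w) = fst (snd u) * fst (snd v)"
    using sgn_affine_comp uv(3,4) by blast
  have N: "sgn_affine x \<in> p2gg_N \<longleftrightarrow> fst x = fst (snd x)" if "x \<in> sgn_affine_par" for x
    using that sgn_affine_in_N_iff by (cases x) auto
  have "fst u = 1 \<or> fst u = -1" "fst (snd u) = 1 \<or> fst (snd u) = -1"
      "fst v = 1 \<or> fst v = -1" "fst (snd v) = 1 \<or> fst (snd v) = -1"
    using uv(3,4) by (auto simp: sgn_affine_par_def)
  then show ?thesis
    unfolding uv(1,2) w(2) N[OF uv(3)] N[OF uv(4)] N[OF w(1)] w(3,4)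
    by (elim disjE) simp_all
qed

lemma subgroup_p2gg_N: "subgroup p2gg_N p2gg"
proof -
  interpret group p2gg by (rule group_p2gg)
  have id: "id \<in> p2gg_N"
    using p2gg_comp_in_N_iff[of id id] one_closed by (simp add: p2gg_one)
  show ?thesis
  proof
    fix f assume f: "f \<in> p2gg_N"
    then have c: "f \<in> carrier p2gg" using p2gg_N_subset by blast
    have "inv\<^bsub>p2gg\<^esub> f \<circ> f = id" using l_inv[OF c] by (simp add: p2gg_mult p2gg_one)
    then show "inv\<^bsub>p2gg\<^esub> f \<in> p2gg_N"
      using p2gg_comp_in_N_iff[OF inv_closed[OF c] c] f id by simp
  qed (use p2gg_N_subset id p2gg_comp_in_N_iff in \<open>auto simp: p2gg_mult p2gg_one\<close>)
qed

lemma subgroup_C4_H: "subgroup C4_H C4"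
proof -
  interpret group C4 by simp
  have 2: "inv\<^bsub>C4\<^esub> 2 = 2" by (rule inv_equality) (auto simp: carrier_C4)
  have 0: "inv\<^bsub>C4\<^esub> 0 = 0" using inv_one by simp
  show ?thesis by unfold_locales (auto simp: C4_H_def carrier_C4 0 2)
qed

text \<open>The pullback with both quotient maps eliminated: equality of two classes in C2 becomes
  equivalence of two membership conditions. The kernel of the first projection consists of (id, 0)
  and (id, 2) and is central.\<close>

definition p2gg_C4 :: "((real \<times> real \<Rightarrow> real \<times> real) \<times> int) monoid" where
  "p2gg_C4 = (p2gg \<times>\<times> C4)\<lparr>carrier :=
     {(f, c). f \<in> carrier p2gg \<and> c \<in> carrier C4 \<and> (f \<in> p2gg_N \<longleftrightarrow> c \<in> C4_H)}\<rparr>"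

text \<open>A group of order two has only the trivial automorphism, so the choice of
  \<open>\<iota>\<close> and \<open>\<kappa>\<close> cannot influence the pullback.\<close>

lemma pullback_group_eq_p2gg_C4:
  assumes "\<iota> \<in> iso (p2gg Mod p2gg_N) C2" and "\<kappa> \<in> iso (C4 Mod C4_H) C2"
  shows "pullback_group p2gg C4 (\<lambda>\<gamma>. \<iota> (p2gg_N #>\<^bsub>p2gg\<^esub> \<gamma>)) (\<lambda>c. \<kappa> (C4_H #>\<^bsub>C4\<^esub> c)) = p2gg_C4"
proof -
  have "\<iota> (p2gg_N #>\<^bsub>p2gg\<^esub> f) = \<kappa> (C4_H #>\<^bsub>C4\<^esub> c) \<longleftrightarrow> (f \<in> p2gg_N \<longleftrightarrow> c \<in> C4_H)"
    if "f \<in> carrier p2gg" "c \<in> carrier C4" for f c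
    using iso_C2_rcos[OF group_p2gg subgroup_p2gg_N assms(1) that(1)]
      iso_C2_rcos[OF _ subgroup_C4_H assms(2) that(2)] by simp
  then show ?thesis
    unfolding pullback_group_def p2gg_C4_def
    by (intro arg_cong[where f = "\<lambda>X. (p2gg \<times>\<times> C4)\<lparr>carrier := X\<rparr>"]) blast
qed

lemma carrier_p2gg_C4:
  "(f, c) \<in> carrier p2gg_C4 \<longleftrightarrow>
     f \<in> carrier p2gg \<and> c \<in> {0, 1, 2, 3} \<and> (f \<in> p2gg_N \<longleftrightarrow> c \<in> {0, 2})"
  by (simp add: p2gg_C4_def carrier_C4 C4_H_def)

lemma p2gg_C4_mult: "x \<otimes>\<^bsub>p2gg_C4\<^esub> y = (fst x \<circ> fst y, (snd x + snd y) mod 4)"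
  by (simp add: p2gg_C4_def DirProd_def p2gg_mult split: prod.splits)

lemma p2gg_C4_one: "\<one>\<^bsub>p2gg_C4\<^esub> = (id, 0)"
  by (simp add: p2gg_C4_def DirProd_def p2gg_one)

text \<open>Both membership conditions are parities that add under products and survive inversion,
  so their equivalence cuts out a subgroup of the direct product.\<close>

lemma group_p2gg_C4: "group p2gg_C4"
proof -
  interpret D: group "p2gg \<times>\<times> C4" by (intro DirProd_group group_p2gg) simp
  interpret P: group p2gg by (rule group_p2gg)
  interpret C: group C4 by simp
  interpret N: subgroup p2gg_N p2gg by (rule subgroup_p2gg_N)
  have Z: "c \<otimes>\<^bsub>C4\<^esub> d \<in> C4_H \<longleftrightarrow> (c \<in> C4_H \<longleftrightarrow> d \<in> C4_H)"
    if "c \<in> carrier C4" "d \<in> carrier C4" for c d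
    using that by (auto simp: C4_H_def carrier_C4)
  have "subgroup (carrier p2gg_C4) (p2gg \<times>\<times> C4)"
  proof (rule D.subgroupI)
    show "carrier p2gg_C4 \<subseteq> carrier (p2gg \<times>\<times> C4)" by (auto simp: p2gg_C4_def)
    have "(id, 0) \<in> carrier p2gg_C4"
      using P.one_closed N.one_closed by (simp add: carrier_p2gg_C4 p2gg_one)
    then show "carrier p2gg_C4 \<noteq> {}" by blast
  next
    fix x assume x: "x \<in> carrier p2gg_C4"
    obtain f c where fc: "x = (f, c)" by (cases x)
    have f: "f \<in> carrier p2gg" "c \<in> carrier C4" "f \<in> p2gg_N \<longleftrightarrow> c \<in> C4_H"
      using x by (auto simp: fc p2gg_C4_def)
    have "inv\<^bsub>p2gg\<^esub> f \<in> p2gg_N \<longleftrightarrow> f \<in> p2gg_N"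
      using p2gg_comp_in_N_iff[OF P.inv_closed[OF f(1)] f(1)] P.l_inv[OF f(1)] N.one_closed
      by (simp add: p2gg_mult)
    moreover have "inv\<^bsub>C4\<^esub> c \<in> C4_H \<longleftrightarrow> c \<in> C4_H"
      using Z[OF C.inv_closed[OF f(2)] f(2)] C.l_inv[OF f(2)] by (simp add: C4_H_def)
    ultimately show "inv\<^bsub>p2gg \<times>\<times> C4\<^esub> x \<in> carrier p2gg_C4"
      using f P.inv_closed[OF f(1)] C.inv_closed[OF f(2)]
      by (simp add: fc inv_DirProd[OF group_p2gg] p2gg_C4_def del: inv_integer_mod_group)
  next
    fix x y assume "x \<in> carrier p2gg_C4" "y \<in> carrier p2gg_C4"
    then show "x \<otimes>\<^bsub>p2gg \<times>\<times> C4\<^esub> y \<in> carrier p2gg_C4"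
      using p2gg_comp_in_N_iff Z P.m_closed C.m_closed
      by (auto simp: p2gg_C4_def DirProd_def p2gg_mult simp del: mult_integer_mod_group)
  qed
  then have "group ((p2gg \<times>\<times> C4)\<lparr>carrier := carrier p2gg_C4\<rparr>)"
    by (rule D.subgroup_imp_group)
  then show ?thesis by (simp add: p2gg_C4_def)
qed

lemma group_action_p2gg_C4: "group_action p2gg_C4 UNIV fst"
proof -
  have "bij f" if "f \<in> carrier p2gg" for f
  proof -
    interpret P: group p2gg by (rule group_p2gg)
    have "inv\<^bsub>p2gg\<^esub> f \<circ> f = id" "f \<circ> inv\<^bsub>p2gg\<^esub> f = id"
      using P.l_inv[OF that] P.r_inv[OF that] by (simp_all add: p2gg_mult p2gg_one)
    then show ?thesis by (rule o_bij)
  qed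
  then have "fst \<in> hom p2gg_C4 (BijGroup UNIV)"
    by (intro homI) (auto simp: BijGroup_def Bij_def carrier_p2gg_C4 p2gg_C4_mult compose_def comp_def)
  then show ?thesis
    by (simp add: group_action_def group_hom_def group_hom_axioms_def group_p2gg_C4 group_BijGroup)
qed

lemma p2gg_C4_cases:
  assumes "g \<in> carrier p2gg_C4"
  obtains s t a b c where "g = (sgn_affine (s, t, a, b), c)" "(s, t, a, b) \<in> sgn_affine_par"
    "c \<in> {0, 1, 2, 3}" "s = t \<longleftrightarrow> c \<in> {0, 2}"
proof -
  obtain f c where g: "g = (f, c)" by (cases g)
  then obtain s t a b where "f = sgn_affine (s, t, a, b)" "(s, t, a, b) \<in> sgn_affine_par"
    using assms unfolding g carrier_p2gg_C4 carrier_p2gg by (metis imageE prod_cases4)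
  then show thesis
    using that assms sgn_affine_in_N_iff by (simp add: g carrier_p2gg_C4)
qed

lemma sgn_affine_in_p2gg_C4:
  "(sgn_affine (s, t, a, b), c) \<in> carrier p2gg_C4 \<longleftrightarrow>
     (s, t, a, b) \<in> sgn_affine_par \<and> c \<in> {0, 1, 2, 3} \<and> (s = t \<longleftrightarrow> c \<in> {0, 2})"
  using sgn_affine_in_N_iff by (auto simp: carrier_p2gg_C4 carrier_p2gg image_iff sgn_affine_inject)

section \<open>Orientations\<close>

text \<open>Here \<open>a i\<close> stands for the sign of a nonvanishing section over
  \<open>U i\<close>, measured against an arbitrary choice of basis vectors. The function
  \<open>s\<close> changes the signs of these vectors so that they agree locally with the sections
  up to a locally constant sign: an orientation of the line bundle over \<open>S\<close>.\<close>

definition orientable_on ::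
    "'i set \<Rightarrow> ('i \<Rightarrow> 'a::t2_space set) \<Rightarrow> ('i \<Rightarrow> 'a \<Rightarrow> real) \<Rightarrow> 'a set \<Rightarrow> bool" where
  "orientable_on I U a S \<longleftrightarrow> (\<exists>s. (\<forall>x. s x \<in> {1, - 1}) \<and>
     (\<forall>i\<in>I. continuous_on (S \<inter> U i) (\<lambda>x. s x * a i x)))"

lemma orientable_on_subset:
  "orientable_on I U a S \<Longrightarrow> T \<subseteq> S \<Longrightarrow> orientable_on I U a T"
  unfolding orientable_on_def by (meson Int_mono continuous_on_subset subset_refl)

lemma continuous_on_open_nbhds:
  fixes f :: "'a::t2_space \<Rightarrow> 'b::topological_space"
  assumes "\<And>x. x \<in> S \<Longrightarrow> \<exists>U. open U \<and> x \<in> U \<and> continuous_on (S \<inter> U) f"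
  shows "continuous_on S f"
  unfolding continuous_on_eq_continuous_within
proof
  fix x assume x: "x \<in> S"
  then obtain U where U: "open U" "x \<in> U" "continuous_on (S \<inter> U) f"
    using assms by blast
  then have "continuous (at x within S \<inter> U) f"
    using x by (simp add: continuous_on_eq_continuous_within)
  moreover have "at x within S \<inter> U = at x within S"
    using U(1,2) by (intro at_within_nhd[of x U]) auto
  ultimately show "continuous (at x within S) f" by simp
qed

text \<open>On the overlap the two orientations differ by a continuous sign, which is constant by
  connectedness, so one of them can be multiplied by that constant. Closedness of both pieces makes
  the pasted function continuous.\<close>

lemma orientable_on_Un:
  fixes U :: "'i \<Rightarrow> 'a::t2_space set"
  assumes op: "\<And>i. i \<in> I \<Longrightarrow> open (U i)" and cov: "(\<Union>i\<in>I. U i) = UNIV"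
    and a: "\<And>i x. i \<in> I \<Longrightarrow> x \<in> U i \<Longrightarrow> a i x \<in> {1, - 1}"
    and ST: "closed S" "closed T" "connected (S \<inter> T)"
    and oS: "orientable_on I U a S" and oT: "orientable_on I U a T"
  shows "orientable_on I U a (S \<union> T)"
proof -
  obtain s where s: "\<And>x. s x \<in> {1, - 1}"
      and cs: "\<And>i. i \<in> I \<Longrightarrow> continuous_on (S \<inter> U i) (\<lambda>x. s x * a i x)"
    using oS unfolding orientable_on_def by blast
  obtain t where t: "\<And>x. t x \<in> {1, - 1}"
      and ct: "\<And>i. i \<in> I \<Longrightarrow> continuous_on (T \<inter> U i) (\<lambda>x. t x * a i x)"
    using oT unfolding orientable_on_def by blast
  have "continuous_on (S \<inter> T) (\<lambda>x. s x * t x)"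
  proof (rule continuous_on_open_nbhds)
    fix x assume "x \<in> S \<inter> T"
    obtain i where i: "i \<in> I" "x \<in> U i" using cov by blast
    \<comment> \<open>The square of \<open>a i x\<close> is 1, so the local factors cancel and the
      product of the two orientations is continuous.\<close>
    have "continuous_on (S \<inter> T \<inter> U i) (\<lambda>x. (s x * a i x) * (t x * a i x))"
      by (intro continuous_on_mult continuous_on_subset[OF cs[OF i(1)]]
          continuous_on_subset[OF ct[OF i(1)]]) auto
    moreover have "(s x * a i x) * (t x * a i x) = s x * t x" if "x \<in> U i" for x
      using a[OF i(1) that] by auto
    ultimately have "continuous_on (S \<inter> T \<inter> U i) (\<lambda>x. s x * t x)"
      by (rule continuous_on_eq) blast
    then show "\<exists>V. open V \<and> x \<in> V \<and> continuous_on (S \<inter> T \<inter> V) (\<lambda>x. s x * t x)"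
      using i op by blast
  qed
  moreover have "finite ((\<lambda>x. s x * t x) ` (S \<inter> T))"
  proof (rule finite_subset)
    have "s x * t x \<in> {1, - 1}" for x using s[of x] t[of x] by auto
    then show "(\<lambda>x. s x * t x) ` (S \<inter> T) \<subseteq> {1, - 1}" by blast
  qed simp
  ultimately have "(\<lambda>x. s x * t x) constant_on (S \<inter> T)"
    using ST(3) continuous_finite_range_constant by blast
  then obtain c' where c': "\<And>x. x \<in> S \<inter> T \<Longrightarrow> s x * t x = c'"
    unfolding constant_on_def by blast
  \<comment> \<open>An empty overlap counts as connected but determines no sign; there the value 1
    is used.\<close>
  define c where "c = (if S \<inter> T = {} then 1 else c')"
  have c1: "c \<in> {1, - 1}"
  proof (cases "S \<inter> T = {}")
    case False
    then obtain x where "x \<in> S \<inter> T" by blast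
    then have "s x * t x = c" using c' False by (simp add: c_def)
    then show ?thesis using s[of x] t[of x] by auto
  qed (simp add: c_def)
  have c: "s x = c * t x" if "x \<in> S \<inter> T" for x
  proof -
    have "s x * t x = c" using c' that by (auto simp: c_def)
    then show ?thesis using t[of x] by auto
  qed
  define r where "r x = (if x \<in> S then s x else c * t x)" for x
  have "r x \<in> {1, - 1}" for x using s[of x] t[of x] c1 by (auto simp: r_def)
  moreover have "continuous_on ((S \<union> T) \<inter> U i) (\<lambda>x. r x * a i x)" if i: "i \<in> I" for i
  proof -
    have "continuous_on ((S \<inter> U i) \<union> (T \<inter> U i))
        (\<lambda>x. if x \<in> S then s x * a i x else c * (t x * a i x))"
    proof (rule continuous_on_cases_local)
      show "closedin (top_of_set ((S \<inter> U i) \<union> (T \<inter> U i))) (S \<inter> U i)"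
        unfolding closedin_closed using ST(1) by (intro exI[of _ S]) auto
      show "closedin (top_of_set ((S \<inter> U i) \<union> (T \<inter> U i))) (T \<inter> U i)"
        unfolding closedin_closed using ST(2) by (intro exI[of _ T]) auto
      show "continuous_on (S \<inter> U i) (\<lambda>x. s x * a i x)" using cs i by blast
      show "continuous_on (T \<inter> U i) (\<lambda>x. c * (t x * a i x))"
        using ct[OF i] by (rule continuous_on_mult_left)
      show "s x * a i x = c * (t x * a i x)"
        if "x \<in> S \<inter> U i \<and> x \<notin> S \<or> x \<in> T \<inter> U i \<and> x \<in> S" for x
        using c[of x] that by auto
    qed
    moreover have "(if x \<in> S then s x * a i x else c * (t x * a i x)) = r x * a i x" for x
      by (simp add: r_def)
    ultimately show ?thesis by (simp add: Int_Un_distrib2)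
  qed
  ultimately show ?thesis unfolding orientable_on_def by blast
qed

text \<open>Bisection runs in one coordinate at a time. Small boxes lie in a single
  \<open>U i\<close>, stacking them makes thin columns orientable, and joining columns fills the
  box. Every overlap is a possibly degenerate segment, hence connected.\<close>

lemma orientable_on_box:
  fixes U :: "'i \<Rightarrow> (real \<times> real) set"
  assumes op: "\<And>i. i \<in> I \<Longrightarrow> open (U i)" and cov: "(\<Union>i\<in>I. U i) = UNIV"
    and a: "\<And>i x. i \<in> I \<Longrightarrow> x \<in> U i \<Longrightarrow> a i x \<in> {1, - 1}"
    and aa: "\<And>i j. i \<in> I \<Longrightarrow> j \<in> I \<Longrightarrow> continuous_on (U i \<inter> U j) (\<lambda>x. a i x * a j x)"
    and "l \<le> r" "b \<le> t"
  shows "orientable_on I U a ({l..r} \<times> {b..t})"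
proof -
  note glue = orientable_on_Un[where a = a and U = U and I = I, OF op cov a]
  have loc: "\<exists>d>0. \<forall>p q u v. p \<le> x \<and> x \<le> q \<and> q - p < d \<and> u \<le> y \<and> y \<le> v \<and> v - u < d \<longrightarrow>
      orientable_on I U a ({p..q} \<times> {u..v})" for x y
  proof -
    obtain i where i: "i \<in> I" "(x, y) \<in> U i" using cov by blast
    obtain P Q where PQ: "open P" "open Q" "(x, y) \<in> P \<times> Q" "P \<times> Q \<subseteq> U i"
      by (rule open_prod_elim[OF op[OF i(1)] i(2)])
    obtain d where "d > 0" and d: "ball x d \<subseteq> P" "ball y d \<subseteq> Q"
    proof -
      obtain d1 where "d1 > 0" "ball x d1 \<subseteq> P" using PQ by (auto elim: openE)
      moreover obtain d2 where "d2 > 0" "ball y d2 \<subseteq> Q" using PQ by (auto elim: openE)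
      ultimately show ?thesis
        using that[of "min d1 d2"] subset_ball[of "min d1 d2" d1 x] subset_ball[of "min d1 d2" d2 y]
          \<open>d1 > 0\<close> by auto
    qed
    \<comment> \<open>Over a single \<open>U i\<close> the local section itself is an orientation:
      with \<open>s = a i\<close> the products are the transition signs.\<close>
    have "orientable_on I U a (U i)"
      unfolding orientable_on_def
    proof (intro exI conjI allI ballI)
      fix z show "(if z \<in> U i then a i z else 1) \<in> {1, - 1}" using a[OF i(1)] by auto
    next
      fix j assume "j \<in> I"
      then show "continuous_on (U i \<inter> U j) (\<lambda>z. (if z \<in> U i then a i z else 1) * a j z)"
        by (intro continuous_on_eq[OF aa[OF i(1)]]) auto
    qed
    moreover have "{p..q} \<times> {u..v} \<subseteq> U i"
      if "p \<le> x \<and> x \<le> q \<and> q - p < d \<and> u \<le> y \<and> y \<le> v \<and> v - u < d" for p q u v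
    proof -
      have "{p..q} \<subseteq> ball x d" "{u..v} \<subseteq> ball y d"
        using that by (auto simp: dist_real_def)
      then show ?thesis using d PQ(4) by blast
    qed
    ultimately have "\<forall>p q u v. p \<le> x \<and> x \<le> q \<and> q - p < d \<and> u \<le> y \<and> y \<le> v \<and> v - u < d \<longrightarrow>
      orientable_on I U a ({p..q} \<times> {u..v})"
      by (meson orientable_on_subset)
    then show ?thesis using \<open>d > 0\<close> by (rule_tac exI[of _ d]) simp
  qed
  \<comment> \<open>The admissible width shrinks whenever two pieces are stacked, so its existence
    is part of the property that is bisected.\<close>
  define col where "col x u v \<longleftrightarrow> (\<exists>d>0. \<forall>p q. p \<le> x \<and> x \<le> q \<and> q - p < d \<longrightarrow>
      orientable_on I U a ({p..q} \<times> {u..v}))" for x u v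
  have col: "col x b t" for x
    using \<open>b \<le> t\<close>
  proof (induction rule: Bolzano)
    case (trans u v w)
    from trans(1) obtain d1 where "d1 > 0" and d1: "\<And>p q. p \<le> x \<and> x \<le> q \<and> q - p < d1 \<Longrightarrow>
      orientable_on I U a ({p..q} \<times> {u..v})" unfolding col_def by blast
    from trans(2) obtain d2 where "d2 > 0" and d2: "\<And>p q. p \<le> x \<and> x \<le> q \<and> q - p < d2 \<Longrightarrow>
      orientable_on I U a ({p..q} \<times> {v..w})" unfolding col_def by blast
    show ?case unfolding col_def
    proof (intro exI conjI allI impI)
      show "min d1 d2 > 0" using \<open>d1 > 0\<close> \<open>d2 > 0\<close> by simp
      fix p q assume pq: "p \<le> x \<and> x \<le> q \<and> q - p < min d1 d2"
      have "({p..q} \<times> {u..v}) \<inter> ({p..q} \<times> {v..w}) = {p..q} \<times> {v}"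
        using trans(3,4) by auto
      then have "orientable_on I U a (({p..q} \<times> {u..v}) \<union> ({p..q} \<times> {v..w}))"
        using d1[of p q] d2[of p q] pq
        by (intro glue) (auto intro!: closed_Times connected_Times)
      moreover have "({p..q} \<times> {u..v}) \<union> ({p..q} \<times> {v..w}) = {p..q} \<times> {u..w}"
        using trans(3,4) by auto
      ultimately show "orientable_on I U a ({p..q} \<times> {u..w})" by simp
    qed
  next
    case (local y)
    obtain d where d: "d > 0" "\<And>p q u v. p \<le> x \<and> x \<le> q \<and> q - p < d \<and> u \<le> y \<and> y \<le> v \<and> v - u < d
        \<Longrightarrow> orientable_on I U a ({p..q} \<times> {u..v})" using loc[of x y] by blast
    then show ?case unfolding col_def by blast
  qed
  show ?thesis
    using \<open>l \<le> r\<close>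
  proof (induction rule: Bolzano)
    case (trans u v w)
    have "({u..v} \<times> {b..t}) \<inter> ({v..w} \<times> {b..t}) = {v} \<times> {b..t}"
      using trans(3,4) by auto
    then have "orientable_on I U a (({u..v} \<times> {b..t}) \<union> ({v..w} \<times> {b..t}))"
      using trans(1,2) by (intro glue) (auto intro!: closed_Times connected_Times)
    moreover have "({u..v} \<times> {b..t}) \<union> ({v..w} \<times> {b..t}) = {u..w} \<times> {b..t}"
      using trans(3,4) by auto
    ultimately show ?case by simp
  next
    case (local x)
    then show ?case using col[of x] unfolding col_def by blast
  qed
qed

section \<open>Equivariant line bundles\<close>

text \<open>The isomorphism with \<open>real^1\<close> is determined by the image \<open>e\<close>
  of the basis vector. The laws for \<open>fscale\<close> are transported from
  \<open>real^1\<close>, since the record of a bundle carries no axioms by itself.\<close>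

lemma fibre_rep_iso_line:
  fixes \<alpha> :: "'g \<Rightarrow> real^1^1" and E :: "('e, 'x) vbundle"
  assumes "fibre_rep_iso S \<alpha> E \<psi> x"
  obtains e where "bij_betw (\<lambda>c. fscale E c e) UNIV (fibre E x)" "fscale E 1 e = e"
    "\<And>c d. fscale E c (fscale E d e) = fscale E (c * d) e"
    "\<And>s. s \<in> S \<Longrightarrow> \<psi> s e = fscale E (\<alpha> s $ 1 $ 1) e"
proof -
  obtain L :: "real^1 \<Rightarrow> 'e" where L: "bij_betw L UNIV (fibre E x)"
      "\<And>c v. L (c *\<^sub>R v) = fscale E c (L v)"
      "\<And>s v. s \<in> S \<Longrightarrow> L (\<alpha> s *v v) = \<psi> s (L v)"
    using assms unfolding fibre_rep_iso_def by blast
  define u :: "real^1" where "u = vec 1"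
  have u: "v = (v $ 1) *\<^sub>R u" for v :: "real^1"
    by (simp add: vec_eq_iff u_def forall_1)
  have "bij (\<lambda>c. c *\<^sub>R u)"
    by (rule bijI, simp_all add: inj_def surj_def)
      (auto simp: u_def vec_eq_iff forall_1 intro: exI[of _ "_ $ 1"])
  then have "bij_betw (L \<circ> (\<lambda>c. c *\<^sub>R u)) UNIV (fibre E x)"
    using L(1) by (rule bij_betw_trans)
  then have 1: "bij_betw (\<lambda>c. fscale E c (L u)) UNIV (fibre E x)"
    by (simp add: o_def L(2))
  show thesis
  proof (rule that[OF 1])
    show "fscale E 1 (L u) = L u" by (metis L(2) scaleR_one)
    show "fscale E c (fscale E d (L u)) = fscale E (c * d) (L u)" for c d
      by (metis L(2) scaleR_scaleR)
    fix s assume s: "s \<in> S"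
    have "\<alpha> s *v u = (\<alpha> s $ 1 $ 1) *\<^sub>R u"
      by (simp add: vec_eq_iff matrix_vector_mult_def u_def forall_1)
    then show "\<psi> s (L u) = fscale E (\<alpha> s $ 1 $ 1) (L u)"
      using L(2,3) s by metis
  qed
qed

text \<open>
  A choice of nonzero vectors \<open>e x\<close> in the fibres turns the action into the cocycle \<open>m\<close> and
  the first basis section of the local trivialization around \<open>y\<close> into the function \<open>a y\<close>.
\<close>

lemma G_line_bundle_cocycle:
  fixes \<phi> :: "'g \<Rightarrow> 'x::topological_space \<Rightarrow> 'x" and E :: "('e, 'x) vbundle" and G (structure)
  assumes bdl: "G_vector_bundle G euclidean \<phi> E \<psi>" and act: "group_action G UNIV \<phi>"
    and rep: "\<And>x. \<exists>\<alpha> :: 'g \<Rightarrow> real^1^1. fibre_rep_iso (stabilizer G \<phi> x) \<alpha> E \<psi> x \<and>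
        (\<forall>s\<in>stabilizer G \<phi> x. \<alpha> s $ 1 $ 1 = \<epsilon> s)"
  obtains U :: "'x \<Rightarrow> 'x set" and a :: "'x \<Rightarrow> 'x \<Rightarrow> real" and m :: "'g \<Rightarrow> 'x \<Rightarrow> real"
  where "\<And>y. open (U y)" "\<And>y. y \<in> U y" "\<And>y x. x \<in> U y \<Longrightarrow> a y x \<noteq> 0"
    "\<And>g h x. g \<in> carrier G \<Longrightarrow> h \<in> carrier G \<Longrightarrow> m (g \<otimes> h) x = m g (\<phi> h x) * m h x"
    "\<And>g x. g \<in> stabilizer G \<phi> x \<Longrightarrow> m g x = \<epsilon> g"
    "\<And>g y z. g \<in> carrier G \<Longrightarrow>
       continuous_on {x \<in> U y. \<phi> g x \<in> U z} (\<lambda>x. a y x * m g x / a z (\<phi> g x))"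
proof -
  interpret group_action G UNIV \<phi> by fact
  have vb: "real_vector_bundle euclidean E" and \<psi>_act: "group_action G (topspace (total E)) \<psi>"
    using bdl by (auto simp: G_vector_bundle_def)
  have \<psi>_homeo: "homeomorphic_map (total E) (total E) (\<psi> g)" if "g \<in> carrier G" for g
    using bdl that by (auto simp: G_vector_bundle_def)
  have \<psi>: "proj E (\<psi> g v) = \<phi> g x" "\<psi> g (fscale E c v) = fscale E c (\<psi> g v)"
    if "g \<in> carrier G" "v \<in> fibre E x" for g v x c
    using bdl that by (auto simp: G_vector_bundle_def)
  have \<psi>_fibre: "\<psi> g v \<in> fibre E (\<phi> g x)" if "g \<in> carrier G" "v \<in> fibre E x" for g v x
    using \<psi>(1)[OF that] homeomorphic_imp_continuous_map[OF \<psi>_homeo[OF that(1)]] that(2)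
    by (auto simp: fibre_def continuous_map_def Pi_iff)
  have "\<exists>e. bij_betw (\<lambda>c. fscale E c e) UNIV (fibre E x) \<and> fscale E 1 e = e \<and>
      (\<forall>c d. fscale E c (fscale E d e) = fscale E (c * d) e) \<and>
      (\<forall>s\<in>stabilizer G \<phi> x. \<psi> s e = fscale E (\<epsilon> s) e)" for x
  proof -
    obtain \<alpha> :: "'g \<Rightarrow> real^1^1" where "fibre_rep_iso (stabilizer G \<phi> x) \<alpha> E \<psi> x"
      and *: "\<And>s. s \<in> stabilizer G \<phi> x \<Longrightarrow> \<alpha> s $ 1 $ 1 = \<epsilon> s" using rep by blast
    from this(1) show ?thesis by (rule fibre_rep_iso_line) (metis *)
  qed
  then obtain e where bij: "\<And>x. bij_betw (\<lambda>c. fscale E c (e x)) UNIV (fibre E x)"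
    and one: "\<And>x. fscale E 1 (e x) = e x"
    and assoc: "\<And>x c d. fscale E c (fscale E d (e x)) = fscale E (c * d) (e x)"
    and stab: "\<And>x s. s \<in> stabilizer G \<phi> x \<Longrightarrow> \<psi> s (e x) = fscale E (\<epsilon> s) (e x)"
    by metis
  have inj: "c = d" if "fscale E c (e x) = fscale E d (e x)" for c d x
    using bij[of x] that by (auto simp: bij_betw_def inj_def)
  have in_fibre: "fscale E c (e x) \<in> fibre E x" for c x
    using bij[of x] by (auto simp: bij_betw_def)
  have e: "e x \<in> fibre E x" for x
    using in_fibre[of 1] by (simp add: one)
  have coord: "\<exists>c. v = fscale E c (e x)" if "v \<in> fibre E x" for v x
    using bij[of x] that by (auto simp: bij_betw_def)
  have "\<exists>c. g \<in> carrier G \<longrightarrow> \<psi> g (e x) = fscale E c (e (\<phi> g x))" for g x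
    using coord[OF \<psi>_fibre[OF _ e]] by blast
  then obtain m where m: "\<And>g x. g \<in> carrier G \<Longrightarrow> \<psi> g (e x) = fscale E (m g x) (e (\<phi> g x))"
    by metis
  have m_mult: "m (g \<otimes> h) x = m g (\<phi> h x) * m h x" if gh: "g \<in> carrier G" "h \<in> carrier G" for g h x
  proof (rule inj)
    interpret \<psi>: group_action G "topspace (total E)" \<psi> by fact
    interpret G: group G using group_hom group_hom.axioms(1) by blast
    have "fscale E (m (g \<otimes> h) x) (e (\<phi> (g \<otimes> h) x)) = \<psi> (g \<otimes> h) (e x)"
      using gh by (simp add: m)
    also have "\<dots> = \<psi> g (\<psi> h (e x))"
      using e[of x] gh by (intro \<psi>.composition_rule) (auto simp: fibre_def)
    also have "\<dots> = fscale E (m h x) (\<psi> g (e (\<phi> h x)))"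
      using gh by (simp add: m \<psi>(2)[OF _ e])
    also have "\<dots> = fscale E (m h x * m g (\<phi> h x)) (e (\<phi> g (\<phi> h x)))"
      using gh by (simp add: m assoc)
    finally show "fscale E (m (g \<otimes> h) x) (e (\<phi> (g \<otimes> h) x)) =
        fscale E (m g (\<phi> h x) * m h x) (e (\<phi> (g \<otimes> h) x))"
      using composition_rule[of x g h] gh by (simp add: mult.commute)
  qed
  have m_stab: "m g x = \<epsilon> g" if "g \<in> stabilizer G \<phi> x" for g x
    using that stab[OF that] m[of g x] by (intro inj[of _ x]) (auto simp: stabilizer_def)
  \<comment> \<open>Naming the condition allows neighbourhood, rank and trivialization to be chosen
    together for all points at once.\<close>
  define chart where "chart y U k h \<longleftrightarrow> openin euclidean U \<and> y \<in> U \<and>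
        homeomorphic_map (prod_topology (subtopology euclidean U) (Euclidean_space k))
          (subtopology (total E) {e \<in> topspace (total E). proj E e \<in> U}) h \<and>
        (\<forall>y\<in>U. \<forall>v\<in>topspace (Euclidean_space k).
           proj E (h (y, v)) = y \<and>
           (\<forall>w\<in>topspace (Euclidean_space k).
              h (y, \<lambda>i. v i + w i) = fadd E (h (y, v)) (h (y, w))) \<and>
           (\<forall>c. h (y, \<lambda>i. c * v i) = fscale E c (h (y, v))))" for y U k h
  have "\<forall>y. \<exists>U k h. chart y U k h"
    using vb by (simp add: real_vector_bundle_def chart_def)
  then obtain U k h where "\<And>y. chart y (U y) (k y) (h y)" by metis
  then have U: "open (U y)" "y \<in> U y"
    and h: "homeomorphic_map (prod_topology (top_of_set (U y)) (Euclidean_space (k y)))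
          (subtopology (total E) {e \<in> topspace (total E). proj E e \<in> U y}) (h y)"
    and proj: "x \<in> U y \<Longrightarrow> v \<in> topspace (Euclidean_space (k y)) \<Longrightarrow> proj E (h y (x, v)) = x"
    and scale: "x \<in> U y \<Longrightarrow> v \<in> topspace (Euclidean_space (k y)) \<Longrightarrow>
        h y (x, \<lambda>i. c * v i) = fscale E c (h y (x, v))" for y x v c
    by (simp_all add: chart_def)
  define \<delta> :: "nat \<Rightarrow> real" where "\<delta> = (\<lambda>i. if i = 0 then 1 else 0)"
  have h_im: "h y ` (U y \<times> topspace (Euclidean_space (k y))) = {e \<in> topspace (total E). proj E e \<in> U y}"
    and h_inj: "inj_on (h y) (U y \<times> topspace (Euclidean_space (k y)))" for y
    using homeomorphic_imp_surjective_map[OF h[of y]] homeomorphic_imp_injective_map[OF h[of y]]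
    by auto
  \<comment> \<open>The first basis vector exists only in positive rank. In rank 0 the fibre over
    \<open>y\<close> would be a single point, although the multiples of \<open>e y\<close> by 0 and
    1 differ.\<close>
  have \<delta>: "\<delta> \<in> topspace (Euclidean_space (k y))" for y
  proof (cases "k y = 0")
    case True
    have "v = h y (y, \<lambda>i. 0)" if "v \<in> fibre E y" for v
    proof -
      have "v \<in> h y ` (U y \<times> topspace (Euclidean_space (k y)))"
        unfolding h_im using that U(2)[of y] by (auto simp: fibre_def)
      then obtain x w where w: "v = h y (x, w)" "x \<in> U y" "w \<in> topspace (Euclidean_space (k y))"
        by blast
      then have "x = y" using proj[of x y w] that by (auto simp: fibre_def)
      moreover have "w = (\<lambda>i. 0)" using w(3) True by (auto simp: topspace_Euclidean_space)
      ultimately show ?thesis using w by simp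
    qed
    then have "fscale E 0 (e y) = fscale E 1 (e y)" using in_fibre by metis
    then show ?thesis using inj by fastforce
  qed (auto simp: topspace_Euclidean_space \<delta>_def)
  define a where "a y x = (SOME c. h y (x, \<delta>) = fscale E c (e x))" for y x
  have "h y (x, \<delta>) \<in> fibre E x" if "x \<in> U y" for x y
    using proj[OF that \<delta>] h_im[of y] that \<delta>[of y] by (auto simp: fibre_def)
  then have "\<exists>c. h y (x, \<delta>) = fscale E c (e x)" if "x \<in> U y" for x y
    using coord that by blast
  then have a: "h y (x, \<delta>) = fscale E (a y x) (e x)" if "x \<in> U y" for x y
    unfolding a_def by (rule someI_ex) (rule that)
  \<comment> \<open>A vanishing coefficient would give the zero vector and \<open>\<delta>\<close>
    the same image under the injective trivialization.\<close>
  have a0: "a y x \<noteq> 0" if x: "x \<in> U y" for x y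
  proof
    assume "a y x = 0"
    then have "h y (x, \<lambda>i. 0 * \<delta> i) = h y (x, \<delta>)"
      using scale[OF x \<delta>, of 0] a[OF x] assoc[of 0 0 x] by simp
    moreover have "(\<lambda>i. 0 * \<delta> i) \<in> topspace (Euclidean_space (k y))"
      by (simp add: topspace_Euclidean_space)
    ultimately have "(\<lambda>i. 0 * \<delta> i) = \<delta>"
      using inj_onD[OF h_inj[of y]] x \<delta>[of y] by (metis Pair_inject mem_Sigma_iff)
    then have "0 * \<delta> 0 = \<delta> 0" by (rule fun_cong)
    then show False by (simp add: \<delta>_def)
  qed
  \<comment> \<open>This quotient is the coordinate of the translated section in the trivialization
    around \<open>z\<close>, hence continuous, whereas \<open>a\<close> and \<open>m\<close> alone
    depend on the arbitrary vectors \<open>e x\<close>.\<close>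
  have cont: "continuous_on {x \<in> U y. \<phi> g x \<in> U z} (\<lambda>x. a y x * m g x / a z (\<phi> g x))"
    if g: "g \<in> carrier G" for g y z
  proof -
    let ?W = "{x \<in> U y. \<phi> g x \<in> U z}" and ?r = "\<lambda>x. a y x * m g x / a z (\<phi> g x)"
    obtain h' where h': "homeomorphic_maps (prod_topology (top_of_set (U z)) (Euclidean_space (k z)))
          (subtopology (total E) {e \<in> topspace (total E). proj E e \<in> U z}) (h z) h'"
      using h[of z] homeomorphic_map_maps by blast
    have eq: "\<psi> g (h y (x, \<delta>)) = h z (\<phi> g x, \<lambda>i. ?r x * \<delta> i)" if x: "x \<in> ?W" for x
    proof -
      have "\<psi> g (h y (x, \<delta>)) = fscale E (a y x * m g x) (e (\<phi> g x))"
        using x g by (simp add: a \<psi>(2)[OF g e] m assoc)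
      also have "\<dots> = h z (\<phi> g x, \<lambda>i. ?r x * \<delta> i)"
        using x a0[of "\<phi> g x" z] by (subst scale) (simp_all add: \<delta> a assoc)
      finally show ?thesis .
    qed
    have "continuous_map (top_of_set ?W) (prod_topology (top_of_set (U y)) (Euclidean_space (k y)))
        (\<lambda>x. (x, \<delta>))"
      using \<delta>[of y] by (intro continuous_map_pairedI) (auto simp: continuous_map_in_subtopology)
    then have "continuous_map (top_of_set ?W)
        (subtopology (total E) {e \<in> topspace (total E). proj E e \<in> U y}) (h y \<circ> (\<lambda>x. (x, \<delta>)))"
      using homeomorphic_imp_continuous_map[OF h[of y]] by (rule continuous_map_compose)
    then have "continuous_map (top_of_set ?W) (total E) (h y \<circ> (\<lambda>x. (x, \<delta>)))"
      by (simp add: continuous_map_in_subtopology)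
    then have c: "continuous_map (top_of_set ?W) (total E) (\<psi> g \<circ> (h y \<circ> (\<lambda>x. (x, \<delta>))))"
      using homeomorphic_imp_continuous_map[OF \<psi>_homeo[OF g]] by (rule continuous_map_compose)
    have r\<delta>: "(\<lambda>i. r * \<delta> i) \<in> topspace (Euclidean_space (k z))" for r
      using \<delta>[of z] by (auto simp: topspace_Euclidean_space)
    have "continuous_map (top_of_set ?W)
        (subtopology (total E) {e \<in> topspace (total E). proj E e \<in> U z}) (\<psi> g \<circ> (h y \<circ> (\<lambda>x. (x, \<delta>))))"
      unfolding continuous_map_in_subtopology
    proof (intro conjI c)
      have "\<psi> g (h y (x, \<delta>)) \<in> {e \<in> topspace (total E). proj E e \<in> U z}" if "x \<in> ?W" for x
        unfolding eq[OF that] h_im[of z, symmetric] using that r\<delta> by blast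
      then show "\<psi> g \<circ> (h y \<circ> (\<lambda>x. (x, \<delta>))) \<in> topspace (top_of_set ?W) \<rightarrow>
          {e \<in> topspace (total E). proj E e \<in> U z}"
        by auto
    qed
    then have "continuous_map (top_of_set ?W) (prod_topology (top_of_set (U z)) (Euclidean_space (k z)))
        (h' \<circ> (\<psi> g \<circ> (h y \<circ> (\<lambda>x. (x, \<delta>)))))"
      using h' unfolding homeomorphic_maps_def by (blast intro: continuous_map_compose)
    then have "continuous_map (top_of_set ?W) (Euclidean_space (k z))
        (\<lambda>x. snd (h' (\<psi> g (h y (x, \<delta>)))))"
      by (auto simp: continuous_map_pairwise o_def)
    then have "continuous_map (top_of_set ?W) (Euclidean_space (k z)) (\<lambda>x i. ?r x * \<delta> i)"
    proof (rule continuous_map_eq)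
      fix x assume "x \<in> topspace (top_of_set ?W)"
      then have x: "x \<in> ?W" by simp
      then show "snd (h' (\<psi> g (h y (x, \<delta>)))) = (\<lambda>i. ?r x * \<delta> i)"
        unfolding eq[OF x] using h' r\<delta>[of "?r x"] by (simp add: homeomorphic_maps_def)
    qed
    then have "continuous_map (top_of_set ?W) (powertop_real UNIV) (\<lambda>x i. ?r x * \<delta> i)"
      by (simp add: Euclidean_space_def continuous_map_in_subtopology)
    then have "continuous_map (top_of_set ?W) euclideanreal (\<lambda>x. ?r x * \<delta> 0)"
      by (simp only: continuous_map_componentwise_UNIV) 
    then show ?thesis by (simp add: \<delta>_def)
  qed
  show thesis by (rule that[OF U a0 m_mult m_stab cont])
qed

section \<open>Equivariant cells of proper actions\<close>

lemma disk_eq: "disk n = top_of_set {v. (\<forall>i\<ge>n. v i = 0) \<and> (\<Sum>i<n. (v i)\<^sup>2) \<le> 1}"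
  by (simp add: disk_def Euclidean_space_def euclidean_product_topology subtopology_subtopology
      Collect_conj_eq)

lemma topspace_disk: "topspace (disk n) = {v. (\<forall>i\<ge>n. v i = 0) \<and> (\<Sum>i<n. (v i)\<^sup>2) \<le> 1}"
  by (simp add: disk_eq)

text \<open>The disk is a closed subset of an infinite product of intervals [-1, 1], which is
  compact by Tychonoff's theorem.\<close>

lemma compact_space_disk: "compact_space (disk n)"
proof -
  let ?D = "{v :: nat \<Rightarrow> real. (\<forall>i\<ge>n. v i = 0) \<and> (\<Sum>i<n. (v i)\<^sup>2) \<le> 1}"
  have "?D = (\<Inter>i\<in>{n..}. {v. v i = 0}) \<inter> {v. (\<Sum>i<n. (v i)\<^sup>2) \<le> 1}" by auto
  moreover have "closed {v :: nat \<Rightarrow> real. v i = 0}" for i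
    by (intro closed_Collect_eq continuous_intros continuous_on_product_coordinates)
  moreover have "closed {v :: nat \<Rightarrow> real. (\<Sum>i<n. (v i)\<^sup>2) \<le> 1}"
    by (intro closed_Collect_le continuous_intros continuous_on_product_coordinates)
  ultimately have cl: "closed ?D" by (auto intro!: closed_Inter closed_Int)
  have "compactin (powertop_real UNIV) (PiE UNIV (\<lambda>i. {- 1..1}))"
    by (simp add: compactin_PiE)
  then have co: "compact (PiE UNIV (\<lambda>i :: nat. {- 1..1 :: real}))"
    by (simp add: euclidean_product_topology)
  have "?D \<subseteq> PiE UNIV (\<lambda>i. {- 1..1})"
  proof
    fix v assume v: "v \<in> ?D"
    have "\<bar>v i\<bar> \<le> 1" for i
    proof (cases "i < n")
      case True
      then have "(v i)\<^sup>2 \<le> (\<Sum>i<n. (v i)\<^sup>2)" by (intro member_le_sum) auto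
      then have "(v i)\<^sup>2 \<le> 1" using v by simp
      then show ?thesis by (simp add: abs_square_le_1)
    qed (use v in auto)
    then show "v \<in> PiE UNIV (\<lambda>i. {- 1..1})" by (auto simp: abs_le_iff minus_le_iff)
  qed
  then have "compact ?D"
    using compact_Int_closed[OF co cl] by (simp add: Int_absorb1)
  then show ?thesis by (simp add: disk_eq compact_space_subtopology)
qed

text \<open>Convergent sequences are bounded. For a cell complex this reduces closedness to finitely
  many cells at a time.\<close>

lemma closed_if_bounded_parts_closed:
  fixes Z :: "'a::real_normed_vector set"
  assumes "\<And>R. closed (Z \<inter> cball 0 R)"
  shows "closed Z"
proof -
  have "x \<in> Z" if x: "\<forall>n. f n \<in> Z" "f \<longlonglongrightarrow> x" for f x
  proof -
    obtain R where "\<And>n. norm (f n) \<le> R"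
      using convergent_imp_Bseq[OF convergentI[OF x(2)]] by (auto simp: Bseq_def)
    then have "\<forall>n. f n \<in> Z \<inter> cball 0 R" using x by simp
    then show ?thesis
      using assms[of R] x(2) unfolding closed_sequential_limits by blast
  qed
  then show ?thesis unfolding closed_sequential_limits by blast
qed

text \<open>A product with a discrete factor is a disjoint union of copies; this lets openness in
  \<open>orbit_cell\<close> be tested one coset at a time.\<close>

lemma openin_prod_discrete:
  "openin (prod_topology (discrete_topology D) Y) {p \<in> D \<times> topspace Y. P p} \<longleftrightarrow>
     (\<forall>d\<in>D. openin Y {y \<in> topspace Y. P (d, y)})"
proof
  assume L: "openin (prod_topology (discrete_topology D) Y) {p \<in> D \<times> topspace Y. P p}"
  show "\<forall>d\<in>D. openin Y {y \<in> topspace Y. P (d, y)}"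
  proof
    fix d assume d: "d \<in> D"
    then have "continuous_map Y (prod_topology (discrete_topology D) Y) (\<lambda>y. (d, y))"
      by (intro continuous_map_pairedI) auto
    from openin_continuous_map_preimage[OF this L]
    show "openin Y {y \<in> topspace Y. P (d, y)}" using d by (simp add: conj_commute cong: conj_cong)
  qed
next
  assume R: "\<forall>d\<in>D. openin Y {y \<in> topspace Y. P (d, y)}"
  have "{p \<in> D \<times> topspace Y. P p} = (\<Union>d\<in>D. {d} \<times> {y \<in> topspace Y. P (d, y)})" by auto
  then show "openin (prod_topology (discrete_topology D) Y) {p \<in> D \<times> topspace Y. P p}"
    using R by (auto intro!: openin_Union simp: openin_prod_Times_iff)
qed

text \<open>This depends on the choice of \<open>g\<close> unless the isotropy group fixes the cell \<open>f\<close> pointwise.\<close>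

definition cell_map :: "('g \<Rightarrow> 'x \<Rightarrow> 'x) \<Rightarrow> ('v \<Rightarrow> 'x) \<Rightarrow> 'g set \<times> 'v \<Rightarrow> 'x" where
  "cell_map \<phi> f = (\<lambda>(c, v). \<phi> (SOME g. g \<in> c) (f v))"

text \<open>The hypotheses \<open>cover\<close> and \<open>disjoint\<close> give the bijection on
  open cells; together with \<open>H_fix\<close>, the latter says that every interior point of a
  cell has isotropy group \<open>H i\<close>. For the topology, properness makes the translates of
  the compact cells locally finite, so a subset of \<open>B\<close> whose traces on \<open>A\<close>
  and on all cells are closed is closed.\<close>

lemma attaches_orbit_cells_cell_map:
  fixes \<phi> :: "'g \<Rightarrow> 'x::euclidean_space \<Rightarrow> 'x" and G (structure)
    and H :: "'i \<Rightarrow> 'g set" and f :: "'i \<Rightarrow> (nat \<Rightarrow> real) \<Rightarrow> 'x"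
  assumes act: "group_action G UNIV \<phi>"
    and \<phi>_cont: "\<And>g. g \<in> carrier G \<Longrightarrow> continuous_on UNIV (\<phi> g)"
    and proper: "\<And>K. compact K \<Longrightarrow> finite {g \<in> carrier G. \<phi> g ` K \<inter> K \<noteq> {}}"
    and I: "finite I"
    and A: "closed A" "\<And>g x. g \<in> carrier G \<Longrightarrow> x \<in> A \<Longrightarrow> \<phi> g x \<in> A"
    and B: "closed B" "\<And>g x. g \<in> carrier G \<Longrightarrow> x \<in> B \<Longrightarrow> \<phi> g x \<in> B"
    and AB: "A \<subseteq> B"
    and H: "\<And>i. i \<in> I \<Longrightarrow> subgroup (H i) G"
    and H_fix: "\<And>i h v. i \<in> I \<Longrightarrow> h \<in> H i \<Longrightarrow> v \<in> topspace (disk n) \<Longrightarrow> \<phi> h (f i v) = f i v"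
    and f_cont: "\<And>i. i \<in> I \<Longrightarrow> continuous_map (disk n) euclidean (f i)"
    and f_B: "\<And>i v. i \<in> I \<Longrightarrow> v \<in> topspace (disk n) \<Longrightarrow> f i v \<in> B"
    and f_A: "\<And>i v. i \<in> I \<Longrightarrow> v \<in> disk_boundary n \<Longrightarrow> f i v \<in> A"
    and f_int: "\<And>i v. i \<in> I \<Longrightarrow> v \<in> topspace (disk n) - disk_boundary n \<Longrightarrow> f i v \<notin> A"
    and cover: "\<And>x. x \<in> B - A \<Longrightarrow>
        \<exists>i\<in>I. \<exists>g\<in>carrier G. \<exists>v\<in>topspace (disk n) - disk_boundary n. x = \<phi> g (f i v)"
    and disjoint: "\<And>i j g v w. i \<in> I \<Longrightarrow> j \<in> I \<Longrightarrow> g \<in> carrier G \<Longrightarrow>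
        v \<in> topspace (disk n) - disk_boundary n \<Longrightarrow> w \<in> topspace (disk n) - disk_boundary n \<Longrightarrow>
        \<phi> g (f i v) = f j w \<Longrightarrow> i = j \<and> v = w \<and> g \<in> H i"
  shows "attaches_orbit_cells G euclidean \<phi> n A B ((\<lambda>i. (H i, cell_map \<phi> (f i))) ` I)"
proof -
  interpret group_action G UNIV \<phi> by fact
  interpret G: group G using group_hom group_hom.axioms(1) by blast
  let ?D = "topspace (disk n)" and ?bD = "disk_boundary n"
  have bd: "?bD \<subseteq> ?D" by (auto simp: disk_boundary_def)
  have coset: "\<exists>g\<in>carrier G. c = g <# H i" if "c \<in> lcosets H i" for c i
    using that by (auto simp: LCOSETS_def)
  have rep: "(SOME g. g \<in> c) \<in> carrier G \<and> c = (SOME g. g \<in> c) <# H i"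
    if i: "i \<in> I" and c: "c \<in> lcosets H i" for c i
  proof -
    obtain g where g: "g \<in> carrier G" "c = g <# H i" using coset[OF c] by blast
    then have "g \<in> c" using G.lcos_self[OF g(1) H[OF i]] by simp
    then have s: "(SOME g. g \<in> c) \<in> g <# H i" using someI[of "\<lambda>g. g \<in> c"] g(2) by simp
    then have "g <# H i = (SOME g. g \<in> c) <# H i"
      by (rule G.l_repr_independence[OF _ g(1) H[OF i]])
    moreover have "(SOME g. g \<in> c) \<in> carrier G"
      using G.l_coset_carrier[OF s g(1) H[OF i]] .
    ultimately show ?thesis using g(2) by simp
  qed
  \<comment> \<open>Another representative of the coset differs by an element of \<open>H i\<close>,
    which fixes the cell pointwise, so the value does not depend on the one picked by
    \<open>SOME\<close>.\<close>
  have cell: "cell_map \<phi> (f i) (g <# H i, v) = \<phi> g (f i v)"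
    if i: "i \<in> I" and g: "g \<in> carrier G" and v: "v \<in> ?D" for i g v
  proof -
    let ?s = "SOME h. h \<in> g <# H i"
    have "g <# H i \<in> lcosets H i" using g by (auto simp: LCOSETS_def)
    have "g \<in> g <# H i" using G.lcos_self[OF g H[OF i]] .
    then have "?s \<in> g <# H i" by (rule someI)
    then obtain h where h: "h \<in> H i" "?s = g \<otimes> h" by (auto simp: l_coset_def)
    then have "\<phi> ?s (f i v) = \<phi> g (\<phi> h (f i v))"
      using composition_rule[of _ g h] g subgroup.mem_carrier[OF H[OF i]] by simp
    then show ?thesis by (simp add: cell_map_def H_fix[OF i h(1) v])
  qed
  have cellE: "\<exists>g\<in>carrier G. c = g <# H i \<and> (\<forall>v\<in>?D. cell_map \<phi> (f i) (c, v) = \<phi> g (f i v))"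
    if "i \<in> I" "c \<in> lcosets H i" for i c
    using coset[OF that(2)] cell[OF that(1)] by blast
  have one: "\<phi> \<one> x = x" for x using id_eq_one by (metis UNIV_I restrict_apply')
  have inv: "\<phi> (inv g) (\<phi> g x) = x" if "g \<in> carrier G" for g x
    using composition_rule[of x "inv g" g] that one by simp
  have A': "\<phi> g x \<in> A \<longleftrightarrow> x \<in> A" if "g \<in> carrier G" for g x
    using A(2)[OF that, of x] A(2)[of "inv g" "\<phi> g x"] inv[OF that] that by auto

  have "bij_betw (\<lambda>((H, \<Phi>), p). \<Phi> p)
       (SIGMA (H, \<Phi>):(\<lambda>i. (H i, cell_map \<phi> (f i))) ` I. (lcosets H) \<times> (?D - ?bD)) (B - A)"
    (is "bij_betw ?ev ?Sig _")
    unfolding bij_betw_def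
  proof (intro conjI inj_onI equalityI subsetI)
    fix x y assume xy: "x \<in> ?Sig" "y \<in> ?Sig" "?ev x = ?ev y"
    from xy(1) obtain i c v where x: "i \<in> I" "x = ((H i, cell_map \<phi> (f i)), (c, v))"
      "c \<in> lcosets H i" "v \<in> ?D - ?bD" by auto
    from xy(2) obtain j d w where y: "j \<in> I" "y = ((H j, cell_map \<phi> (f j)), (d, w))"
      "d \<in> lcosets H j" "w \<in> ?D - ?bD" by auto
    obtain g where g: "g \<in> carrier G" "c = g <# H i" "cell_map \<phi> (f i) (c, v) = \<phi> g (f i v)"
      using cellE[OF x(1,3)] x(4) by blast
    obtain h where h: "h \<in> carrier G" "d = h <# H j" "cell_map \<phi> (f j) (d, w) = \<phi> h (f j w)"
      using cellE[OF y(1,3)] y(4) by blast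
    have "\<phi> g (f i v) = \<phi> h (f j w)" using xy(3) x(2) y(2) g(3) h(3) by simp
    \<comment> \<open>Translating back by \<open>inv h\<close> moves the second point into its
      reference cell, where \<open>disjoint\<close> applies.\<close>
    then have "\<phi> (inv h \<otimes> g) (f i v) = f j w"
      using composition_rule[of _ "inv h" g] g(1) h(1) inv[OF h(1)] by simp
    from disjoint[OF x(1) y(1) _ x(4) y(4) this]
    have *: "i = j" "v = w" "inv h \<otimes> g \<in> H i" using g(1) h(1) by auto
    have "g = h \<otimes> (inv h \<otimes> g)" using g(1) h(1) by (simp add: G.m_assoc[symmetric])
    then have "g \<in> h <# H i" unfolding l_coset_def using *(3) by blast
    then have "h <# H i = g <# H i"
      using G.l_repr_independence[OF _ h(1) H[OF x(1)]] by blast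
    then show "x = y" using x(2) y(2) g(2) h(2) * by simp
  next
    fix y assume "y \<in> ?ev ` ?Sig"
    then obtain i c v where i: "i \<in> I" "y = cell_map \<phi> (f i) (c, v)"
      "c \<in> lcosets H i" "v \<in> ?D - ?bD" by auto
    then obtain g where "g \<in> carrier G" "y = \<phi> g (f i v)" using cellE[OF i(1,3)] by auto
    then show "y \<in> B - A" using B(2) A' f_B[OF i(1)] f_int[OF i(1)] i(4) by auto
  next
    fix x assume "x \<in> B - A"
    then obtain i g v where i: "i \<in> I" "g \<in> carrier G" "v \<in> ?D - ?bD" "x = \<phi> g (f i v)"
      using cover by blast
    then have "x = ?ev ((H i, cell_map \<phi> (f i)), (g <# H i, v))" using cell by simp
    moreover have "((H i, cell_map \<phi> (f i)), (g <# H i, v)) \<in> ?Sig"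
      using i by (auto simp: LCOSETS_def)
    ultimately show "x \<in> ?ev ` ?Sig" by (rule image_eqI)
  qed
  moreover have "openin (top_of_set B) U \<longleftrightarrow> openin (top_of_set A) (U \<inter> A) \<and>
        (\<forall>i\<in>I. openin (orbit_cell G (H i) n)
          {p \<in> topspace (orbit_cell G (H i) n). cell_map \<phi> (f i) p \<in> U})" if U: "U \<subseteq> B" for U
  proof -
    have slices: "openin (orbit_cell G (H i) n)
          {p \<in> topspace (orbit_cell G (H i) n). cell_map \<phi> (f i) p \<in> U} \<longleftrightarrow>
        (\<forall>g\<in>carrier G. openin (disk n) {v \<in> ?D. \<phi> g (f i v) \<in> U})" if i: "i \<in> I" for i
    proof -
      have "{v \<in> ?D. cell_map \<phi> (f i) (g <# H i, v) \<in> U} = {v \<in> ?D. \<phi> g (f i v) \<in> U}"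
        if "g \<in> carrier G" for g using cell[OF i that] by auto
      then show ?thesis
        by (simp add: orbit_cell_def openin_prod_discrete LCOSETS_def)
    qed
    have gf_cont: "continuous_map (disk n) euclidean (\<lambda>v. \<phi> g (f i v))"
      if "i \<in> I" "g \<in> carrier G" for i g
      using continuous_map_compose[OF f_cont[OF that(1)], of euclidean "\<phi> g"] \<phi>_cont[OF that(2)]
      by (simp add: o_def)
    show ?thesis
    proof
      assume "openin (top_of_set B) U"
      then obtain W where W: "open W" "U = B \<inter> W" by (auto simp: openin_open)
      have "openin (disk n) {v \<in> ?D. \<phi> g (f i v) \<in> U}" if ig: "i \<in> I" "g \<in> carrier G" for i g
      proof -
        have "openin (disk n) {v \<in> ?D. \<phi> g (f i v) \<in> W}"
          using openin_continuous_map_preimage[OF gf_cont[OF ig]] W(1) by simp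
        moreover have "{v \<in> ?D. \<phi> g (f i v) \<in> U} = {v \<in> ?D. \<phi> g (f i v) \<in> W}"
          using W(2) f_B[OF ig(1)] B(2)[OF ig(2)] by auto
        ultimately show ?thesis by simp
      qed
      moreover have "openin (top_of_set A) (U \<inter> A)"
        using W AB by (auto simp: openin_open intro!: exI[of _ W])
      ultimately show "openin (top_of_set A) (U \<inter> A) \<and> (\<forall>i\<in>I. openin (orbit_cell G (H i) n)
          {p \<in> topspace (orbit_cell G (H i) n). cell_map \<phi> (f i) p \<in> U})"
        using slices by simp
    next
      assume "openin (top_of_set A) (U \<inter> A) \<and> (\<forall>i\<in>I. openin (orbit_cell G (H i) n)
          {p \<in> topspace (orbit_cell G (H i) n). cell_map \<phi> (f i) p \<in> U})"
      then have UA: "openin (top_of_set A) (U \<inter> A)"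
        and Ui: "\<And>i g. i \<in> I \<Longrightarrow> g \<in> carrier G \<Longrightarrow> openin (disk n) {v \<in> ?D. \<phi> g (f i v) \<in> U}"
        using slices by auto
      have "closedin (top_of_set A) (A - U \<inter> A)" using UA by (simp add: closedin_diff)
      then have "closed (A - U \<inter> A)" using A(1) by (rule closedin_closed_trans)
      moreover have "A - U \<inter> A = A - U" by blast
      ultimately have clA: "closed (A - U)" by simp
      \<comment> \<open>The part of a translated cell outside \<open>U\<close>. It is the image of a
        closed subset of a compact disk, so finite unions of such parts are closed.\<close>
      define cl where "cl i g = (\<lambda>v. \<phi> g (f i v)) ` {v \<in> ?D. \<phi> g (f i v) \<notin> U}" for i g
      have cl: "compact (cl i g)" if ig: "i \<in> I" "g \<in> carrier G" for i g
      proof -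
        have "closedin (disk n) (?D - {v \<in> ?D. \<phi> g (f i v) \<in> U})"
          using Ui[OF ig] by (intro closedin_diff) auto
        then have "compactin (disk n) (?D - {v \<in> ?D. \<phi> g (f i v) \<in> U})"
          by (rule closedin_compact_space[OF compact_space_disk])
        from image_compactin[OF this gf_cont[OF ig]]
        show ?thesis by (simp add: cl_def set_diff_eq conj_commute cong: conj_cong)
      qed
      have fD: "compact (f i ` ?D)" if "i \<in> I" for i
        using image_compactin[OF _ f_cont[OF that]] compact_space_disk[of n]
        by (simp add: compact_space_def)
      have "closed (B - U)"
      proof (rule closed_if_bounded_parts_closed)
        fix R
        \<comment> \<open>Properness: only finitely many translates of the cells meet the ball.\<close>
        define K where "K = cball 0 R \<union> (\<Union>i\<in>I. f i ` ?D)"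
        have "compact K" unfolding K_def using I fD by (intro compact_Un compact_UN) auto
        define F where "F = {g \<in> carrier G. \<phi> g ` K \<inter> K \<noteq> {}}"
        have F: "finite F" "F \<subseteq> carrier G" unfolding F_def using proper[OF \<open>compact K\<close>] by auto
        have "(B - U) \<inter> cball 0 R = ((A - U) \<union> (\<Union>i\<in>I. \<Union>g\<in>F. cl i g)) \<inter> cball 0 R"
        proof (intro equalityI subsetI)
          fix x assume x: "x \<in> (B - U) \<inter> cball 0 R"
          show "x \<in> ((A - U) \<union> (\<Union>i\<in>I. \<Union>g\<in>F. cl i g)) \<inter> cball 0 R"
          proof (cases "x \<in> A")
            case False
            then obtain i g v where i: "i \<in> I" "g \<in> carrier G" "v \<in> ?D" "x = \<phi> g (f i v)"
              using cover x by blast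
            then have "f i v \<in> K" "\<phi> g (f i v) \<in> K" using x by (auto simp: K_def)
            then have "g \<in> F" using i by (auto simp: F_def)
            moreover have "x \<in> cl i g" using i x by (auto simp: cl_def)
            ultimately show ?thesis using i x by blast
          qed (use x in auto)
        next
          fix x assume "x \<in> ((A - U) \<union> (\<Union>i\<in>I. \<Union>g\<in>F. cl i g)) \<inter> cball 0 R"
          then show "x \<in> (B - U) \<inter> cball 0 R"
            using AB F(2) f_B B(2) by (auto simp: cl_def)
        qed
        moreover have "closed (((A - U) \<union> (\<Union>i\<in>I. \<Union>g\<in>F. cl i g)) \<inter> cball 0 R)"
          using clA I F compact_imp_closed[OF cl] by (intro closed_Int closed_Un closed_UN ballI) auto
        ultimately show "closed ((B - U) \<inter> cball 0 R)" by simp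
      qed
      then have "closedin (top_of_set B) (B - U)"
        by (intro closed_subset) auto
      then have "openin (top_of_set B) (B - (B - U))" by (intro openin_diff) auto
      then show "openin (top_of_set B) U" using U by (simp add: double_diff)
    qed
  qed
  moreover have "cell_map \<phi> (f i) ` topspace (orbit_cell G (H i) n) \<subseteq> B \<and>
        cell_map \<phi> (f i) ` ((lcosets H i) \<times> ?bD) \<subseteq> A \<and>
        (\<forall>g\<in>carrier G. \<forall>c\<in>lcosets H i. \<forall>v\<in>?D.
           cell_map \<phi> (f i) (g <# c, v) = \<phi> g (cell_map \<phi> (f i) (c, v)))" if i: "i \<in> I" for i
  proof (intro conjI ballI)
    show "cell_map \<phi> (f i) ` topspace (orbit_cell G (H i) n) \<subseteq> B"
    proof clarify
      fix c v assume "(c, v) \<in> topspace (orbit_cell G (H i) n)"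
      then have "c \<in> lcosets H i" "v \<in> ?D" by (auto simp: orbit_cell_def)
      with cellE[OF i this(1)] show "cell_map \<phi> (f i) (c, v) \<in> B" using f_B[OF i] B(2) by auto
    qed
    show "cell_map \<phi> (f i) ` ((lcosets H i) \<times> ?bD) \<subseteq> A"
    proof clarify
      fix c v assume "c \<in> lcosets H i" "v \<in> ?bD"
      with cellE[OF i this(1)] show "cell_map \<phi> (f i) (c, v) \<in> A" using f_A[OF i] A(2) bd by auto
    qed
    fix g c v assume g: "g \<in> carrier G" and c: "c \<in> lcosets H i" and v: "v \<in> ?D"
    obtain h where h: "h \<in> carrier G" "c = h <# H i" using coset[OF c] by blast
    then have "g <# c = (g \<otimes> h) <# H i"
      using g by (simp add: G.lcos_m_assoc subgroup.subset[OF H[OF i]])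
    then show "cell_map \<phi> (f i) (g <# c, v) = \<phi> g (cell_map \<phi> (f i) (c, v))"
      using cell[OF i _ v] g h composition_rule[of _ g h] by simp
  qed
  ultimately show ?thesis
    unfolding attaches_orbit_cells_def using AB H by (auto simp del: mem_Sigma_iff)
qed

section \<open>The cell structure of the plane\<close>

lemma p2gg_C4_apply:
  assumes "g \<in> carrier p2gg_C4"
  obtains s t a b where "(s, t, a, b) \<in> sgn_affine_par" "fst g = sgn_affine (s, t, a, b)"
    "\<And>x y. fst g (x, y) = (s * x + of_int a, t * y + of_int b)"
  using assms by (rule p2gg_C4_cases) (rule that, auto simp: sgn_affine_def)

text \<open>Every isometry in \<open>p2gg\<close> lifts, with component 0 if it preserves
  orientation and 1 otherwise, so orbit questions reduce to exhibiting signs and integers.\<close>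

lemma p2gg_C4_moveI:
  assumes "(s, t, a, b) \<in> sgn_affine_par" "x = s * u + of_int a" "y = t * w + of_int b" "(u, w) \<in> Z"
  shows "\<exists>g\<in>carrier p2gg_C4. \<exists>z\<in>Z. (x, y) = fst g z"
proof -
  have "(sgn_affine (s, t, a, b), if s = t then 0 else 1) \<in> carrier p2gg_C4"
    using assms(1) by (simp add: sgn_affine_in_p2gg_C4)
  moreover have "(x, y) = sgn_affine (s, t, a, b) (u, w)"
    using assms(2,3) by (simp add: sgn_affine_def)
  ultimately show ?thesis using assms(4) by (metis fst_conv)
qed

lemma continuous_on_p2gg_C4:
  assumes "g \<in> carrier p2gg_C4"
  shows "continuous_on A (fst g)"
  using assms by (rule p2gg_C4_cases)
    (auto simp: sgn_affine_def case_prod_unfold intro!: continuous_intros)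

text \<open>If a point and its image have coordinates bounded by \<open>M\<close>, the translation
  part is bounded by \<open>2 * M\<close>, which leaves finitely many integers; there are four
  choices of signs and four values of the second component.\<close>

lemma p2gg_C4_proper:
  assumes "compact K"
  shows "finite {g \<in> carrier p2gg_C4. fst g ` K \<inter> K \<noteq> {}}"
proof -
  obtain M where M: "\<And>z. z \<in> K \<Longrightarrow> norm z \<le> M"
    using compact_imp_bounded[OF assms] by (auto simp: bounded_iff)
  have coord: "\<bar>u\<bar> \<le> M \<and> \<bar>w\<bar> \<le> M" if "(u, w) \<in> K" for u w
    using M[OF that] norm_fst_le[of u w] norm_snd_le[of w u] by auto
  define N where "N = \<lceil>2 * M\<rceil>"
  let ?P = "{1, -1} \<times> {1, -1} \<times> {- N..N} \<times> {- N..N} \<times> {0, 1, 2, 3 :: int}"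
  have "{g \<in> carrier p2gg_C4. fst g ` K \<inter> K \<noteq> {}} \<subseteq> (\<lambda>(s, t, a, b, c). (sgn_affine (s, t, a, b), c)) ` ?P"
  proof
    fix g assume "g \<in> {g \<in> carrier p2gg_C4. fst g ` K \<inter> K \<noteq> {}}"
    then obtain x y where g: "g \<in> carrier p2gg_C4" and K: "(x, y) \<in> K" "fst g (x, y) \<in> K" by auto
    from g show "g \<in> (\<lambda>(s, t, a, b, c). (sgn_affine (s, t, a, b), c)) ` ?P"
    proof (rule p2gg_C4_cases)
      fix s t a b c assume g: "g = (sgn_affine (s, t, a, b), c)" "(s, t, a, b) \<in> sgn_affine_par"
        "c \<in> {0, 1, 2, 3}"
      then have st: "s \<in> {1, -1}" "t \<in> {1, -1}" by (auto simp: sgn_affine_par_def)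
      have "(s * x + a, t * y + b) \<in> K" using K(2) g by (simp add: sgn_affine_def)
      then have "\<bar>s * x + a\<bar> \<le> M" "\<bar>t * y + b\<bar> \<le> M" "\<bar>x\<bar> \<le> M" "\<bar>y\<bar> \<le> M"
        using coord K(1) by blast+
      then have "\<bar>real_of_int a\<bar> \<le> 2 * M" "\<bar>real_of_int b\<bar> \<le> 2 * M"
        using st by auto
      then have "real_of_int \<bar>a\<bar> \<le> real_of_int N" "real_of_int \<bar>b\<bar> \<le> real_of_int N"
        unfolding N_def by linarith+
      then have "a \<in> {- N..N}" "b \<in> {- N..N}" by (simp_all only: of_int_le_iff) auto
      then show ?thesis using g st by (intro image_eqI[of _ _ "(s, t, a, b, c)"]) auto
    qed
  qed
  then show ?thesis by (rule finite_subset) auto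
qed

lemma finite_stabilizer_p2gg_C4: "finite (stabilizer p2gg_C4 fst x)"
proof -
  have "stabilizer p2gg_C4 fst x \<subseteq> {g \<in> carrier p2gg_C4. fst g ` {x} \<inter> {x} \<noteq> {}}"
    by (auto simp: stabilizer_def)
  then show ?thesis by (rule finite_subset) (rule p2gg_C4_proper, simp)
qed

section \<open>Integer points and integer lines as invariant skeleta\<close>

definition lattice :: "(real \<times> real) set" where "lattice = \<int> \<times> \<int>"

definition grid :: "(real \<times> real) set" where "grid = \<int> \<times> UNIV \<union> UNIV \<times> \<int>"

lemma closed_lattice: "closed lattice" and closed_grid: "closed grid"
  by (auto simp: lattice_def grid_def intro!: closed_Times closed_Un closed_Ints)

text \<open>Linear parts are diagonal with entries 1 or - 1 and translations are integral, so
  integrality of each coordinate is preserved separately and the two axis directions are never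
  exchanged.\<close>

lemma p2gg_C4_Ints:
  assumes "g \<in> carrier p2gg_C4"
  shows "fst (fst g z) \<in> \<int> \<longleftrightarrow> fst z \<in> \<int>" "snd (fst g z) \<in> \<int> \<longleftrightarrow> snd z \<in> \<int>"
proof -
  obtain s t a b where p: "(s, t, a, b) \<in> sgn_affine_par"
    and g: "\<And>x y. fst g (x, y) = (s * x + of_int a, t * y + of_int b)"
    using p2gg_C4_apply[OF assms] by metis
  have st: "s = 1 \<or> s = -1" "t = 1 \<or> t = -1" using p by (auto simp: sgn_affine_par_def)
  have *: "r * x + of_int k \<in> \<int> \<longleftrightarrow> x \<in> \<int>" if "r = 1 \<or> r = -1" for r x :: real and k
  proof -
    have "r * x + of_int k \<in> \<int> \<longleftrightarrow> r * x \<in> \<int>"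
      using Ints_add[of "r * x" "of_int k"] Ints_diff[of "r * x + of_int k" "of_int k"] by auto
    then show ?thesis using that by auto
  qed
  show "fst (fst g z) \<in> \<int> \<longleftrightarrow> fst z \<in> \<int>" "snd (fst g z) \<in> \<int> \<longleftrightarrow> snd z \<in> \<int>"
    using *[OF st(1)] *[OF st(2)] g[of "fst z" "snd z"] by simp_all
qed

lemma p2gg_C4_lattice: "g \<in> carrier p2gg_C4 \<Longrightarrow> z \<in> lattice \<Longrightarrow> fst g z \<in> lattice"
  and p2gg_C4_grid: "g \<in> carrier p2gg_C4 \<Longrightarrow> z \<in> grid \<Longrightarrow> fst g z \<in> grid"
  by (auto simp: lattice_def grid_def mem_Times_iff p2gg_C4_Ints)

lemma disk_0: "topspace (disk 0) = {\<lambda>i. 0}" "disk_boundary 0 = {}"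
  by (auto simp: topspace_disk disk_boundary_def)

lemma disk_1: "v \<in> topspace (disk 1) \<longleftrightarrow> (\<forall>i\<ge>1. v i = 0) \<and> v 0 \<in> {-1..1}"
  "v \<in> topspace (disk 1) - disk_boundary 1 \<longleftrightarrow> (\<forall>i\<ge>1. v i = 0) \<and> v 0 \<in> {-1<..<1}"
  "v \<in> disk_boundary 1 \<longleftrightarrow> (\<forall>i\<ge>1. v i = 0) \<and> v 0 \<in> {-1, 1}"
proof -
  have "(v 0)\<^sup>2 \<le> 1 \<longleftrightarrow> - 1 \<le> v 0 \<and> v 0 \<le> 1" by (simp add: abs_square_le_1 abs_le_iff) linarith
  moreover have "(\<Sum>i<1. (v i)\<^sup>2) = (v 0)\<^sup>2" by (simp add: lessThan_Suc)
  ultimately show "v \<in> topspace (disk 1) \<longleftrightarrow> (\<forall>i\<ge>1. v i = 0) \<and> v 0 \<in> {-1..1}"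
    "v \<in> topspace (disk 1) - disk_boundary 1 \<longleftrightarrow> (\<forall>i\<ge>1. v i = 0) \<and> v 0 \<in> {-1<..<1}"
    "v \<in> disk_boundary 1 \<longleftrightarrow> (\<forall>i\<ge>1. v i = 0) \<and> v 0 \<in> {-1, 1}"
    unfolding topspace_disk disk_boundary_def by (auto simp: power2_eq_1_iff)
qed

text \<open>Cells are modelled on round disks, but the cell of the plane is a square. Compact convex
  bodies with interior points are homeomorphic, and invariance of domain shows that the
  homeomorphism and its inverse preserve interiors, hence also boundaries.\<close>

lemma disk_2_square:
  obtains q :: "(nat \<Rightarrow> real) \<Rightarrow> real \<times> real" where "continuous_map (disk 2) euclidean q"
    "bij_betw q (topspace (disk 2) - disk_boundary 2) ({0<..<1} \<times> {0<..<1})"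
    "q ` disk_boundary 2 \<subseteq> {0, 1} \<times> UNIV \<union> UNIV \<times> {0, 1}"
proof -
  let ?S = "cbox (0, 0) (1, 1) :: (real \<times> real) set" and ?B = "cball 0 1 :: (real \<times> real) set"
  have "box (0, 0) (1, 1) \<noteq> ({} :: (real \<times> real) set)"
    by (auto simp: box_ne_empty Basis_prod_def)
  then have "?B homeomorphic ?S"
    by (intro homeomorphic_convex_compact) (auto simp: interior_cbox)
  then obtain F F' where F: "homeomorphism ?B ?S F F'" by (auto simp: homeomorphic_def)
  have F_cont: "continuous_on ?B F" "continuous_on ?S F'" and F_im: "F ` ?B = ?S" "F' ` ?S = ?B"
    and F_inv: "\<And>z. z \<in> ?B \<Longrightarrow> F' (F z) = z" "\<And>z. z \<in> ?S \<Longrightarrow> F (F' z) = z"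
    using F by (auto simp: homeomorphism_def)
  have "F ` interior ?B \<subseteq> interior ?S"
    using continuous_image_subset_interior[OF F_cont(1) inj_on_inverseI[of _ F', OF F_inv(1)]]
    by (auto simp: F_im)
  then have Fb: "F ` ball 0 1 \<subseteq> box (0, 0) (1, 1)" by (simp add: interior_cbox)
  have "F' ` interior ?S \<subseteq> interior ?B"
    using continuous_image_subset_interior[OF F_cont(2) inj_on_inverseI[of _ F, OF F_inv(2)]]
    by (auto simp: F_im)
  then have Fb': "F' ` box (0, 0) (1, 1) \<subseteq> ball 0 1" by (simp add: interior_cbox)
  have box: "box (0, 0) (1, 1) = {0<..<1::real} \<times> {0<..<1::real}"
    "cbox (0, 0) (1, 1) = {0..1::real} \<times> {0..1::real}"
    by (auto simp: box_prod cbox_Pair_eq)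
  define e :: "(nat \<Rightarrow> real) \<Rightarrow> real \<times> real" where "e v = (v 0, v 1)" for v
  have e_norm: "norm (e v) = sqrt (\<Sum>i<2. (v i)\<^sup>2)" for v
    by (simp add: e_def norm_Pair numeral_2_eq_2)
  have D: "v \<in> topspace (disk 2) \<longleftrightarrow> (\<forall>i\<ge>2. v i = 0) \<and> e v \<in> cball 0 1"
    "v \<in> topspace (disk 2) - disk_boundary 2 \<longleftrightarrow> (\<forall>i\<ge>2. v i = 0) \<and> e v \<in> ball 0 1"
    "v \<in> disk_boundary 2 \<longleftrightarrow> (\<forall>i\<ge>2. v i = 0) \<and> norm (e v) = 1" for v
    by (auto simp: topspace_disk disk_boundary_def e_norm)
  have e_bij: "bij_betw e {v. \<forall>i\<ge>2. v i = 0} UNIV"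
  proof (rule bij_betwI[where g = "\<lambda>(x, y) i. if i = 0 then x else if i = 1 then y else 0"])
    fix v :: "nat \<Rightarrow> real" assume v: "v \<in> {v. \<forall>i\<ge>2. v i = 0}"
    have "i = 0 \<or> i = 1 \<or> i \<ge> 2" for i :: nat by arith
    then show "(\<lambda>(x, y) i. if i = 0 then x else if i = 1 then y else 0) (e v) = v"
      using v by (force simp: e_def fun_eq_iff)
  qed (auto simp: e_def)
  show thesis
  proof (rule that[of "F \<circ> e"])
    have "continuous_on UNIV e"
      unfolding e_def by (intro continuous_intros continuous_on_product_coordinates)
    then have "continuous_on (topspace (disk 2)) (F \<circ> e)"
      using D(1) by (intro continuous_on_compose continuous_on_subset[OF F_cont(1)])
        (auto intro: continuous_on_subset)
    then show "continuous_map (disk 2) euclidean (F \<circ> e)"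
      using disk_eq[of 2] topspace_disk[of 2] by simp
    have "bij_betw e (topspace (disk 2) - disk_boundary 2) (ball 0 1)"
    proof (rule bij_betw_subset[OF e_bij])
      have "z \<in> e ` (topspace (disk 2) - disk_boundary 2)" if "z \<in> ball 0 1" for z
      proof -
        obtain v where "\<forall>i\<ge>2. v i = 0" "z = e v" using e_bij unfolding bij_betw_def by blast
        then show ?thesis using that D(2)[of v] by blast
      qed
      then show "e ` (topspace (disk 2) - disk_boundary 2) = ball 0 1"
        using D(2) by blast
    qed (use D(2) in blast)
    moreover have "bij_betw F (ball 0 1) (box (0, 0) (1, 1))"
    proof (rule bij_betwI[where g = F'])
      show "F' (F z) = z" if "z \<in> ball 0 1" for z using that F_inv(1)[of z] by simp
      show "F (F' z) = z" if "z \<in> box (0, 0) (1, 1)" for z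
        using that F_inv(2)[of z] box_subset_cbox by blast
    qed (use Fb Fb' in blast)+
    ultimately show "bij_betw (F \<circ> e) (topspace (disk 2) - disk_boundary 2) ({0<..<1} \<times> {0<..<1})"
      using bij_betw_trans unfolding box by blast
    show "(F \<circ> e) ` disk_boundary 2 \<subseteq> {0, 1} \<times> UNIV \<union> UNIV \<times> {0, 1}"
    proof (rule image_subsetI, rule ccontr)
      fix v assume v: "v \<in> disk_boundary 2"
        and nb: "(F \<circ> e) v \<notin> {0, 1} \<times> UNIV \<union> UNIV \<times> {0, 1}"
      have ev: "e v \<in> cball 0 1" using v D(3) by simp
      then have "F (e v) \<in> ?S" using F_im by blast
      then have "F (e v) \<in> box (0, 0) (1, 1)"
        using nb unfolding box by (cases "F (e v)") auto
      then have "F' (F (e v)) \<in> ball 0 1" using Fb' by blast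
      then show False using F_inv(1)[OF ev] v D(3) by simp
    qed
  qed
qed

text \<open>Cells are indexed by points whose stabilizers serve as isotropy groups: the vertex
  itself, the midpoint of an edge, the centre of the square.\<close>

lemmas p2gg_C4_attachesI = attaches_orbit_cells_cell_map[OF group_action_p2gg_C4
    continuous_on_p2gg_C4 p2gg_C4_proper _ _ _ _ _ _
    group_action.stabilizer_subgroup[OF group_action_p2gg_C4 UNIV_I]]

text \<open>The two translation entries have equal parity, so the parity of the coordinate sum is
  invariant; the four parity classes of integer points fall into two orbits.\<close>

lemma p2gg_C4_orbit_lattice:
  "\<exists>g\<in>carrier p2gg_C4. \<exists>z\<in>{(0, 0), (1, 0)}. (of_int m, of_int n) = fst g z"
proof -
  consider "even m" "even n" | "odd m" "odd n" | "even m" "odd n" | "odd m" "even n" by blast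
  then show ?thesis
  proof cases
    case 1 then show ?thesis
      by (intro p2gg_C4_moveI[of 1 1 m n _ 0 _ 0]) (auto simp: sgn_affine_par_def)
  next
    case 2 then show ?thesis
      by (intro p2gg_C4_moveI[of "-1" 1 m n _ 0 _ 0]) (auto simp: sgn_affine_par_def)
  next
    case 3 then show ?thesis
      by (intro p2gg_C4_moveI[of "-1" 1 "m + 1" n _ 1 _ 0]) (auto simp: sgn_affine_par_def)
  next
    case 4 then show ?thesis
      by (intro p2gg_C4_moveI[of 1 1 "m - 1" n _ 1 _ 0]) (auto simp: sgn_affine_par_def)
  qed
qed

lemma p2gg_C4_attaches_vertices:
  "attaches_orbit_cells p2gg_C4 euclidean fst 0 {} lattice
    ((\<lambda>i. (stabilizer p2gg_C4 fst i, cell_map fst (\<lambda>v. i))) ` {(0, 0), (1, 0)})"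
proof (rule p2gg_C4_attachesI, unfold disk_0)
  fix x :: "real \<times> real" assume "x \<in> lattice - {}"
  then obtain m n where "x = (of_int m, of_int n)"
    by (auto simp: lattice_def elim!: Ints_cases)
  then show "\<exists>i\<in>{(0, 0), (1, 0)}. \<exists>g\<in>carrier p2gg_C4. \<exists>v\<in>{\<lambda>i. 0} - {}. x = fst g i"
    using p2gg_C4_orbit_lattice[of m n] by blast
next
  fix i j :: "real \<times> real" and g and v w :: "nat \<Rightarrow> real"
  assume ij: "i \<in> {(0, 0), (1, 0)}" "j \<in> {(0, 0), (1, 0)}"
    and g: "g \<in> carrier p2gg_C4" and eq: "fst g i = j"
    and vw: "v \<in> {\<lambda>i. 0} - {}" "w \<in> {\<lambda>i. 0} - {}"
  obtain s t a b where p: "(s, t, a, b) \<in> sgn_affine_par"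
    and app: "\<And>x y. fst g (x, y) = (s * x + of_int a, t * y + of_int b)"
    using p2gg_C4_apply[OF g] by metis
  \<comment> \<open>The vertices (0, 0) and (1, 0) differ in the parity of the coordinate sum, which
    every element preserves.\<close>
  have "i = j"
  proof (rule ccontr)
    assume "i \<noteq> j"
    then consider "i = (0, 0)" "j = (1, 0)" | "i = (1, 0)" "j = (0, 0)" using ij by auto
    then show False
    proof cases
      case 1
      then have "a = 1" "b = 0" using eq app[of 0 0] by auto
      then show False using p by (auto simp: sgn_affine_par_def)
    next
      case 2
      then have "s + of_int a = 0" and b: "b = 0" using eq app[of 1 0] by auto
      then have "a = 1 \<or> a = -1" using p by (auto simp: sgn_affine_par_def)
      then show False using p b by (auto simp: sgn_affine_par_def)
    qed
  qed
  moreover from this have "g \<in> stabilizer p2gg_C4 fst i"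
    using g eq unfolding stabilizer_def by blast
  ultimately show "i = j \<and> v = w \<and> g \<in> stabilizer p2gg_C4 fst i" using vw by blast
next
  fix i :: "real \<times> real" assume "i \<in> {(0, 0), (1, 0)}"
  then show "i \<in> lattice" by (auto simp: lattice_def)
qed (simp_all add: closed_lattice p2gg_C4_lattice stabilizer_def)

text \<open>The index is the midpoint of the edge, and any index other than \<open>(1/2, 0)\<close>
  denotes the vertical edge. The term \<open>(1 + v 0) / 2\<close> rescales the disk [-1, 1] to
  [0, 1].\<close>

definition edge :: "real \<times> real \<Rightarrow> (nat \<Rightarrow> real) \<Rightarrow> real \<times> real" where
  "edge i v = (if i = (1/2, 0) then ((1 + v 0) / 2, 0) else (0, (1 + v 0) / 2))"

lemma floor_decomp:
  fixes x :: real
  assumes "x \<notin> \<int>"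
  obtains m w where "w \<in> {0<..<1}" "1 - w \<in> {0<..<1}" "x = of_int m + w"
proof (rule that)
  have "x - of_int \<lfloor>x\<rfloor> \<noteq> 0" using assms by (metis Ints_of_int diff_eq_eq add_0)
  then have "0 < x - of_int \<lfloor>x\<rfloor>" "x - of_int \<lfloor>x\<rfloor> < 1" by linarith+
  then show "x - of_int \<lfloor>x\<rfloor> \<in> {0<..<1}" "1 - (x - of_int \<lfloor>x\<rfloor>) \<in> {0<..<1}" by simp_all
qed simp

lemma unit_interval_not_Ints: "x \<in> {0<..<1::real} \<Longrightarrow> x \<notin> \<int>"
  by (auto elim!: Ints_cases)

text \<open>Isometries of the line with integral translation permute the intervals between
  consecutive integers; only the identity and the reflection in 1/2 preserve the one from 0 to
  1.\<close>

lemma unit_interval_move: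
  fixes r x :: real
  assumes "r = 1 \<or> r = -1" "r * x + of_int k \<in> {0<..<1}" "x \<in> {0<..<1}"
  shows "r = 1 \<and> k = 0 \<or> r = -1 \<and> k = 1"
  using assms(1)
proof
  assume r: "r = 1"
  then have "-1 < real_of_int k" "real_of_int k < 1" using assms by auto
  then show ?thesis using r by linarith
next
  assume r: "r = -1"
  then have "0 < real_of_int k" "real_of_int k < 2" using assms by auto
  then show ?thesis using r by linarith
qed

text \<open>The parities of \<open>m\<close> and \<open>n\<close> decide which of the four linear
  parts is used. A reflected coordinate replaces \<open>w\<close> by \<open>1 - w\<close> and shifts
  \<open>m\<close> by one.\<close>

lemma p2gg_C4_orbit_edges:
  assumes "x \<notin> \<int>"
  shows "\<exists>g\<in>carrier p2gg_C4. \<exists>z\<in>{0<..<1} \<times> {0}. (x, of_int n) = fst g z"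
    and "\<exists>g\<in>carrier p2gg_C4. \<exists>z\<in>{0} \<times> {0<..<1}. (of_int n, x) = fst g z"
proof -
  obtain m w where w: "w \<in> {0<..<1}" "1 - w \<in> {0<..<1}" "x = of_int m + w"
    using floor_decomp[OF assms] .
  consider "even m" "even n" | "odd m" "even n" | "even m" "odd n" | "odd m" "odd n" by blast
  then show "\<exists>g\<in>carrier p2gg_C4. \<exists>z\<in>{0<..<1} \<times> {0}. (x, of_int n) = fst g z"
  proof cases
    case 1 then show ?thesis
      by (intro p2gg_C4_moveI[of 1 1 m n _ w _ 0]) (use w in \<open>auto simp: sgn_affine_par_def\<close>)
  next
    case 2 then show ?thesis
      by (intro p2gg_C4_moveI[of "-1" "-1" "m + 1" n _ "1 - w" _ 0]) (use w in \<open>auto simp: sgn_affine_par_def\<close>)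
  next
    case 3 then show ?thesis
      by (intro p2gg_C4_moveI[of "-1" 1 "m + 1" n _ "1 - w" _ 0]) (use w in \<open>auto simp: sgn_affine_par_def\<close>)
  next
    case 4 then show ?thesis
      by (intro p2gg_C4_moveI[of 1 "-1" m n _ w _ 0]) (use w in \<open>auto simp: sgn_affine_par_def\<close>)
  qed
  consider "even m" "even n" | "odd m" "even n" | "even m" "odd n" | "odd m" "odd n" by blast
  then show "\<exists>g\<in>carrier p2gg_C4. \<exists>z\<in>{0} \<times> {0<..<1}. (of_int n, x) = fst g z"
  proof cases
    case 1 then show ?thesis
      by (intro p2gg_C4_moveI[of 1 1 n m _ 0 _ w]) (use w in \<open>auto simp: sgn_affine_par_def\<close>)
  next
    case 2 then show ?thesis
      by (intro p2gg_C4_moveI[of "-1" "-1" n "m + 1" _ 0 _ "1 - w"]) (use w in \<open>auto simp: sgn_affine_par_def\<close>)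
  next
    case 3 then show ?thesis
      by (intro p2gg_C4_moveI[of 1 "-1" n "m + 1" _ 0 _ "1 - w"]) (use w in \<open>auto simp: sgn_affine_par_def\<close>)
  next
    case 4 then show ?thesis
      by (intro p2gg_C4_moveI[of "-1" 1 n m _ 0 _ w]) (use w in \<open>auto simp: sgn_affine_par_def\<close>)
  qed
qed

lemma p2gg_C4_attaches_edges:
  "attaches_orbit_cells p2gg_C4 euclidean fst 1 lattice grid
    ((\<lambda>i. (stabilizer p2gg_C4 fst i, cell_map fst (edge i))) ` {(1/2, 0), (0, 1/2)})"
proof -
  have edge_disjoint: "i = j \<and> v 0 = w 0 \<and> (\<forall>z. fst g z = z)"
    if ij: "i \<in> {(1/2, 0), (0, 1/2)}" "j \<in> {(1/2, 0), (0, 1/2)}"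
      and g: "g \<in> carrier p2gg_C4" and eq: "fst g (edge i v) = edge j w"
      and vw: "v 0 \<in> {-1<..<1}" "w 0 \<in> {-1<..<1}" for i j g v w
  proof -
    obtain s t a b where p: "(s, t, a, b) \<in> sgn_affine_par"
      and app: "\<And>x y. fst g (x, y) = (s * x + of_int a, t * y + of_int b)"
      using p2gg_C4_apply[OF g] by metis
    have st: "s = 1 \<or> s = -1" "t = 1 \<or> t = -1" using p by (auto simp: sgn_affine_par_def)
    let ?v = "(1 + v 0) / 2" and ?w = "(1 + w 0) / 2"
    have vw': "?v \<in> {0<..<1}" "?w \<in> {0<..<1}" using vw by auto
    show ?thesis
    proof (cases "i = (1/2, 0)")
      case True
      have "j = (1/2, 0)"
        using p2gg_C4_Ints(1)[OF g, of "edge i v"] unit_interval_not_Ints[OF vw'(1)] ij(2) True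
        unfolding eq by (auto simp: edge_def)
      then have sv: "s * ?v + of_int a = ?w" and b: "b = 0" using eq True app[of ?v 0] by (auto simp: edge_def)
      then have "s = 1 \<and> a = 0 \<or> s = -1 \<and> a = 1" using unit_interval_move[OF st(1), of ?v a] vw' by simp
      \<comment> \<open>Parity excludes the flip of the edge: \<open>b = 0\<close> is even, so
        \<open>a\<close> is even and cannot be 1. Thus the stabilizer of an edge fixes it
        pointwise.\<close>
      then have "s = 1" "t = 1" "a = 0" using p b by (auto simp: sgn_affine_par_def)
      then show ?thesis using sv b app True \<open>j = _\<close> by (auto simp: field_simps)
    next
      case False
      then have i: "i = (0, 1/2)" using ij(1) by simp
      have "j = (0, 1/2)"
        using p2gg_C4_Ints(2)[OF g, of "edge i v"] unit_interval_not_Ints[OF vw'(1)] ij(2) i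
        unfolding eq by (auto simp: edge_def)
      then have tv: "t * ?v + of_int b = ?w" and a: "a = 0" using eq i app[of 0 ?v] by (auto simp: edge_def)
      then have "t = 1 \<and> b = 0 \<or> t = -1 \<and> b = 1" using unit_interval_move[OF st(2), of ?v b] vw' by simp
      then have "s = 1" "t = 1" "b = 0" using p a by (auto simp: sgn_affine_par_def)
      then show ?thesis using tv a app i \<open>j = _\<close> by (auto simp: field_simps)
    qed
  qed
  \<comment> \<open>The centre of the disk is sent to the index, which brings stabilizers of the
    index under \<open>edge_disjoint\<close>.\<close>
  have edge_centre: "edge i (\<lambda>k. 0) = i" if "i \<in> {(1/2, 0), (0, 1/2)}" for i
    using that by (auto simp: edge_def)
  show ?thesis
  proof (rule p2gg_C4_attachesI)
    fix i :: "real \<times> real" and h and v :: "nat \<Rightarrow> real"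
    assume i: "i \<in> {(1/2, 0), (0, 1/2)}" and h: "h \<in> stabilizer p2gg_C4 fst i"
    then have "fst h (edge i (\<lambda>k. 0)) = edge i (\<lambda>k. 0)"
      by (simp add: edge_centre stabilizer_def)
    moreover have "h \<in> carrier p2gg_C4" using h by (simp add: stabilizer_def)
    ultimately have "\<forall>z. fst h z = z" using edge_disjoint[OF i i, of h "\<lambda>k. 0" "\<lambda>k. 0"] by simp
    then show "fst h (edge i v) = edge i v" ..
  next
    fix i :: "real \<times> real"
    have "continuous_on A (edge i)" for A
      unfolding edge_def
      by (cases "i = (1/2, 0)") (auto intro!: continuous_intros continuous_on_product_coordinates[THEN continuous_on_subset])
    then show "continuous_map (disk 1) euclidean (edge i)" by (simp add: disk_eq)
  next
    fix i :: "real \<times> real" and v :: "nat \<Rightarrow> real"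
    show "edge i v \<in> grid" by (auto simp: edge_def grid_def)
    show "edge i v \<in> lattice" if "v \<in> disk_boundary 1"
      using that unfolding disk_1 by (auto simp: edge_def lattice_def)
    show "edge i v \<notin> lattice" if "v \<in> topspace (disk 1) - disk_boundary 1"
      using that unit_interval_not_Ints[of "(1 + v 0) / 2"] unfolding disk_1 by (auto simp: edge_def lattice_def)
  next
    fix x :: "real \<times> real" assume x: "x \<in> grid - lattice"
    have param: "\<exists>v\<in>topspace (disk 1) - disk_boundary 1. w = (1 + v 0) / 2" if "w \<in> {0<..<1}" for w
    proof (rule bexI[of _ "\<lambda>k. if k = 0 then 2 * w - 1 else 0"])
      show "(\<lambda>k. if k = 0 then 2 * w - 1 else 0) \<in> topspace (disk 1) - disk_boundary 1" unfolding disk_1 using that by auto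
    qed simp
    from x consider n where "fst x \<notin> \<int>" "snd x = of_int n" | n where "snd x \<notin> \<int>" "fst x = of_int n"
      by (auto simp: grid_def lattice_def mem_Times_iff elim!: Ints_cases)
    then show "\<exists>i\<in>{(1/2, 0), (0, 1/2)}. \<exists>g\<in>carrier p2gg_C4.
        \<exists>v\<in>topspace (disk 1) - disk_boundary 1. x = fst g (edge i v)"
    proof cases
      case 1
      obtain g w where g: "g \<in> carrier p2gg_C4" "w \<in> {0<..<1}" "x = fst g (w, 0)"
        using p2gg_C4_orbit_edges(1)[OF 1(1), of n] 1(2) by (cases x) auto
      obtain v where "v \<in> topspace (disk 1) - disk_boundary 1" "w = (1 + v 0) / 2"
        using param[OF g(2)] by blast
      moreover from this(2) have "edge (1/2, 0) v = (w, 0)" by (simp add: edge_def)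
      then have "x = fst g (edge (1/2, 0) v)" using g(3) by simp
      ultimately show ?thesis
        using g(1) by (intro bexI[of _ "(1/2, 0)"] bexI[of _ g] bexI[of _ v]) simp_all
    next
      case 2
      obtain g w where g: "g \<in> carrier p2gg_C4" "w \<in> {0<..<1}" "x = fst g (0, w)"
        using p2gg_C4_orbit_edges(2)[OF 2(1), of n] 2(2) by (cases x) auto
      obtain v where "v \<in> topspace (disk 1) - disk_boundary 1" "w = (1 + v 0) / 2"
        using param[OF g(2)] by blast
      moreover from this(2) have "edge (0, 1/2) v = (0, w)" by (simp add: edge_def)
      then have "x = fst g (edge (0, 1/2) v)" using g(3) by simp
      ultimately show ?thesis
        using g(1) by (intro bexI[of _ "(0, 1/2)"] bexI[of _ g] bexI[of _ v]) simp_all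
    qed
  next
    fix i j :: "real \<times> real" and g and v w :: "nat \<Rightarrow> real"
    assume ij: "i \<in> {(1/2, 0), (0, 1/2)}" "j \<in> {(1/2, 0), (0, 1/2)}" and g: "g \<in> carrier p2gg_C4"
      and vw: "v \<in> topspace (disk 1) - disk_boundary 1" "w \<in> topspace (disk 1) - disk_boundary 1"
      and eq: "fst g (edge i v) = edge j w"
    have "i = j \<and> v 0 = w 0 \<and> (\<forall>z. fst g z = z)"
      using edge_disjoint[OF ij g eq] vw unfolding disk_1 by blast
    moreover have "v k = w k" if "k \<noteq> 0" for k
      using vw that unfolding disk_1 by simp
    ultimately have "i = j" "v = w" "fst g i = i" by (blast, metis ext, blast)
    then show "i = j \<and> v = w \<and> g \<in> stabilizer p2gg_C4 fst i"
      using g by (simp add: stabilizer_def)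
  next
    show "lattice \<subseteq> grid" by (auto simp: lattice_def grid_def)
  qed (simp_all add: closed_lattice closed_grid p2gg_C4_lattice p2gg_C4_grid)
qed

text \<open>The four parity classes of lower left corners correspond to the four linear parts, so
  the unit squares form a single orbit.\<close>

lemma p2gg_C4_orbit_squares:
  assumes "x \<notin> \<int>" "y \<notin> \<int>"
  shows "\<exists>g\<in>carrier p2gg_C4. \<exists>z\<in>{0<..<1} \<times> {0<..<1}. (x, y) = fst g z"
proof -
  obtain m w where w: "w \<in> {0<..<1}" "1 - w \<in> {0<..<1}" "x = of_int m + w"
    using floor_decomp[OF assms(1)] .
  obtain n z where z: "z \<in> {0<..<1}" "1 - z \<in> {0<..<1}" "y = of_int n + z"
    using floor_decomp[OF assms(2)] .
  consider "even m" "even n" | "odd m" "odd n" | "even m" "odd n" | "odd m" "even n" by blast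
  then show ?thesis
  proof cases
    case 1 then show ?thesis
      by (intro p2gg_C4_moveI[of 1 1 m n _ w _ z]) (use w z in \<open>auto simp: sgn_affine_par_def\<close>)
  next
    case 2 then show ?thesis
      by (intro p2gg_C4_moveI[of "-1" "-1" "m + 1" "n + 1" _ "1 - w" _ "1 - z"]) (use w z in \<open>auto simp: sgn_affine_par_def\<close>)
  next
    case 3 then show ?thesis
      by (intro p2gg_C4_moveI[of "-1" 1 "m + 1" n _ "1 - w" _ z]) (use w z in \<open>auto simp: sgn_affine_par_def\<close>)
  next
    case 4 then show ?thesis
      by (intro p2gg_C4_moveI[of 1 "-1" m "n + 1" _ w _ "1 - z"]) (use w z in \<open>auto simp: sgn_affine_par_def\<close>)
  qed
qed

lemma p2gg_C4_attaches_squares: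
  "\<exists>C. attaches_orbit_cells p2gg_C4 euclidean fst 2 grid UNIV C"
proof -
  obtain q :: "(nat \<Rightarrow> real) \<Rightarrow> real \<times> real" where q_cont: "continuous_map (disk 2) euclidean q"
    and q_bij: "bij_betw q (topspace (disk 2) - disk_boundary 2) ({0<..<1} \<times> {0<..<1})"
    and q_bd: "q ` disk_boundary 2 \<subseteq> {0, 1} \<times> UNIV \<union> UNIV \<times> {0, 1}"
    by (rule disk_2_square)
  have q_int: "q v \<in> {0<..<1} \<times> {0<..<1}" if "v \<in> topspace (disk 2) - disk_boundary 2" for v
    using q_bij that by (auto simp: bij_betw_def)
  have disj: "fst g z = z"
    if g: "g \<in> carrier p2gg_C4" and xy: "x \<in> {0<..<1} \<times> {0<..<1}" "fst g x \<in> {0<..<1} \<times> {0<..<1}" for g x z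
  proof -
    obtain s t a b where p: "(s, t, a, b) \<in> sgn_affine_par"
      and app: "\<And>x y. fst g (x, y) = (s * x + of_int a, t * y + of_int b)"
      using p2gg_C4_apply[OF g] by metis
    have st: "s = 1 \<or> s = -1" "t = 1 \<or> t = -1" using p by (auto simp: sgn_affine_par_def)
    have "s = 1 \<and> a = 0 \<or> s = -1 \<and> a = 1" "t = 1 \<and> b = 0 \<or> t = -1 \<and> b = 1"
      using xy unit_interval_move[OF st(1), of "fst x" a] unit_interval_move[OF st(2), of "snd x" b] app[of "fst x" "snd x"]
      by (simp_all add: mem_Times_iff)
    \<comment> \<open>Reflecting one coordinate would make \<open>a\<close> and \<open>b\<close>
      differ in parity, and reflecting both would make them odd although
      \<open>s = t\<close>.\<close>
    then have "s = 1" "t = 1" "a = 0" "b = 0" using p by (auto simp: sgn_affine_par_def)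
    then show ?thesis using app by (cases z) simp
  qed
  let ?c = "(1/2, 1/2) :: real \<times> real"
  have "attaches_orbit_cells p2gg_C4 euclidean fst 2 grid UNIV
      ((\<lambda>i. (stabilizer p2gg_C4 fst i, cell_map fst q)) ` {?c})"
  proof (rule p2gg_C4_attachesI)
    fix i :: "real \<times> real" and h and v :: "nat \<Rightarrow> real"
    assume "i \<in> {?c}" and "h \<in> stabilizer p2gg_C4 fst i"
    then show "fst h (q v) = q v"
      using disj[of h ?c "q v"] by (simp add: stabilizer_def)
  next
    fix v assume "v \<in> disk_boundary 2"
    then show "q v \<in> grid" using q_bd by (auto simp: grid_def)
  next
    fix v assume "v \<in> topspace (disk 2) - disk_boundary 2"
    then show "q v \<notin> grid" using q_int[of v] unit_interval_not_Ints by (auto simp: grid_def)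
  next
    fix x :: "real \<times> real" assume "x \<in> UNIV - grid"
    then obtain g z where g: "g \<in> carrier p2gg_C4" "z \<in> {0<..<1} \<times> {0<..<1}" "x = fst g z"
      using p2gg_C4_orbit_squares[of "fst x" "snd x"] by (auto simp: grid_def mem_Times_iff)
    moreover obtain v where "v \<in> topspace (disk 2) - disk_boundary 2" "z = q v"
      using q_bij g(2) unfolding bij_betw_def by blast
    ultimately show "\<exists>i\<in>{?c}. \<exists>g\<in>carrier p2gg_C4.
        \<exists>v\<in>topspace (disk 2) - disk_boundary 2. x = fst g (q v)"
      by (intro bexI[of _ ?c] bexI[of _ g] bexI[of _ v]) simp_all
  next
    fix i j :: "real \<times> real" and g and v w :: "nat \<Rightarrow> real"
    assume ij: "i \<in> {?c}" "j \<in> {?c}" and g: "g \<in> carrier p2gg_C4"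
      and vw: "v \<in> topspace (disk 2) - disk_boundary 2" "w \<in> topspace (disk 2) - disk_boundary 2"
      and eq: "fst g (q v) = q w"
    have fix_all: "fst g z = z" for z using disj[OF g q_int[OF vw(1)]] q_int[OF vw(2)] eq by simp
    then have "q v = q w" using eq by simp
    then have "v = w" using q_bij vw unfolding bij_betw_def by (meson inj_onD)
    then show "i = j \<and> v = w \<and> g \<in> stabilizer p2gg_C4 fst i"
      using ij g fix_all by (simp add: stabilizer_def)
  qed (simp_all add: closed_grid p2gg_C4_grid q_cont)
  then show ?thesis by blast
qed

lemma G_CW_complex_p2gg_C4: "G_CW_complex p2gg_C4 euclidean fst"
proof -
  obtain C where C: "attaches_orbit_cells p2gg_C4 euclidean fst 2 grid UNIV C"
    using p2gg_C4_attaches_squares by blast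
  \<comment> \<open>Because of the shift in dimension the plane is complete at stage 3; from then on
    the empty family of cells is attached.\<close>
  define Sk where "Sk n = (if n = 0 then {} else if n = 1 then lattice else if n = 2 then grid else UNIV)"
    for n :: nat
  have "\<forall>n. \<exists>C. attaches_orbit_cells p2gg_C4 euclidean fst n (Sk n) (Sk (Suc n)) C"
  proof
    fix n :: nat
    consider "n = 0" | "n = 1" | "n = 2" | "n \<ge> 3" by linarith
    then show "\<exists>C. attaches_orbit_cells p2gg_C4 euclidean fst n (Sk n) (Sk (Suc n)) C"
    proof cases
      case 1
      then have "Sk n = {}" "Sk (Suc n) = lattice" by (simp_all add: Sk_def)
      then show ?thesis using 1 p2gg_C4_attaches_vertices by (simp only:) (rule exI)
    next
      case 2
      then have "Sk n = lattice" "Sk (Suc n) = grid" by (simp_all add: Sk_def)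
      then show ?thesis using 2 p2gg_C4_attaches_edges by (simp only:) (rule exI)
    next
      case 3
      then have "Sk n = grid" "Sk (Suc n) = UNIV" by (simp_all add: Sk_def)
      then show ?thesis using 3 C by (simp only:) (rule exI)
    next
      case 4
      then show ?thesis
        by (intro exI[of _ "{}"]) (auto simp: Sk_def attaches_orbit_cells_def bij_betw_def)
    qed
  qed
  from choice[OF this]
  obtain C' where "\<forall>n. attaches_orbit_cells p2gg_C4 euclidean fst n (Sk n) (Sk (Suc n)) (C' n)" ..
  moreover have Sk3: "Sk 3 = UNIV" by (simp add: Sk_def)
  moreover have "(\<Union>n. Sk n) = UNIV" using Sk3 by blast
  moreover have "openin euclidean U \<longleftrightarrow> (\<forall>n. openin (top_of_set (Sk n)) (U \<inter> Sk n))" for U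
  proof
    assume "\<forall>n. openin (top_of_set (Sk n)) (U \<inter> Sk n)"
    then have "openin (top_of_set (Sk 3)) (U \<inter> Sk 3)" ..
    then show "openin euclidean U" by (simp add: Sk3)
  next
    assume "openin euclidean U"
    then show "\<forall>n. openin (top_of_set (Sk n)) (U \<inter> Sk n)"
      by (intro allI openin_subtopology_Int)
  qed
  moreover have "G_space p2gg_C4 euclidean fst"
    using group_action_p2gg_C4 continuous_on_p2gg_C4 by (simp add: G_space_def)
  moreover have "Sk 0 = {}" by (simp add: Sk_def)
  ultimately show ?thesis
    unfolding G_CW_complex_def topspace_euclidean
    by (intro conjI exI[of _ Sk] exI[of _ C']) simp_all
qed

section \<open>Finite subgroups and compatible collections\<close>

lemma p2gg_C4_affine:
  assumes "g \<in> carrier p2gg_C4" "u + v = 1"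
  shows "fst g (u *\<^sub>R x + v *\<^sub>R y) = u *\<^sub>R fst g x + v *\<^sub>R fst g y"
proof -
  obtain s t a b where app: "\<And>x y. fst g (x, y) = (s * x + of_int a, t * y + of_int b)"
    using p2gg_C4_apply[OF assms(1)] by metis
  have *: "r * (u * x + v * y) + k = u * (r * x + k) + v * (r * y + k)" for r x y k :: real
  proof -
    have "k = (u + v) * k" using assms(2) by simp
    then show ?thesis by (simp add: algebra_simps)
  qed
  show ?thesis
    by (cases x, cases y) (simp add: app *)
qed

lemma finite_subgroupsD:
  "S \<in> finite_subgroups G \<Longrightarrow> subgroup S G \<and> finite S"
  by (simp add: finite_subgroups_def)

lemma finite_subgroups_carrier:
  "S \<in> finite_subgroups G \<Longrightarrow> s \<in> S \<Longrightarrow> s \<in> carrier G"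
  unfolding finite_subgroups_def by (blast dest: subgroup.mem_carrier)

lemma fixed_points_p2gg_C4_nonempty:
  assumes "S \<in> finite_subgroups p2gg_C4"
  shows "fixed_points euclidean fst S \<noteq> {}"
proof -
  interpret group_action p2gg_C4 UNIV fst by (rule group_action_p2gg_C4)
  interpret G: group p2gg_C4 by (rule group_p2gg_C4)
  have S: "subgroup S p2gg_C4" "finite S" using finite_subgroupsD[OF assms] by auto
  interpret S: subgroup S p2gg_C4 by (rule S)
  define c where "c = (\<Sum>s\<in>S. fst s (0, 0)) /\<^sub>R real (card S)"
  have "S \<noteq> {}" using S.one_closed by blast
  then have n: "real (card S) \<noteq> 0" using S(2) by simp
  have "fst g c = c" if g: "g \<in> S" for g
  proof -
    obtain s t a b where app: "\<And>x y. fst g (x, y) = (s * x + of_int a, t * y + of_int b)"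
      using p2gg_C4_apply[OF S.mem_carrier[OF g]] by metis
    \<comment> \<open>The linear part of \<open>g\<close> commutes with the average, and left
      multiplication by \<open>g\<close> merely permutes the summands.\<close>
    define L where "L z = fst g z - fst g (0, 0)" for z
    have L: "linear L"
      by (rule linearI) (auto simp: L_def app algebra_simps)
    have "L c = (\<Sum>h\<in>S. L (fst h (0, 0))) /\<^sub>R real (card S)"
      unfolding c_def by (simp add: linear_cmul[OF L] linear_sum[OF L])
    also have "(\<Sum>h\<in>S. L (fst h (0, 0))) = (\<Sum>h\<in>S. fst g (fst h (0, 0))) - real (card S) *\<^sub>R fst g (0, 0)"
      by (simp add: L_def sum_subtractf scaleR_conv_of_real[symmetric] sum_constant_scaleR)
    also have "(\<Sum>h\<in>S. fst g (fst h (0, 0))) = (\<Sum>h\<in>S. fst (g \<otimes>\<^bsub>p2gg_C4\<^esub> h) (0, 0))"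
      using g by (intro sum.cong) (simp_all add: composition_rule)
    also have "\<dots> = (\<Sum>h\<in>S. fst h (0, 0))"
    proof (rule sum.reindex_bij_witness[where i = "\<lambda>h. inv\<^bsub>p2gg_C4\<^esub> g \<otimes>\<^bsub>p2gg_C4\<^esub> h"
          and j = "\<lambda>h. g \<otimes>\<^bsub>p2gg_C4\<^esub> h"])
    qed (use g in \<open>simp_all add: G.m_assoc[symmetric]\<close>)
    finally have "L c = c - fst g (0, 0)"
      using n by (simp add: c_def scaleR_diff_right)
    then show ?thesis by (simp add: L_def)
  qed
  then have "c \<in> fixed_points euclidean fst S" by (simp add: fixed_points_def)
  then show ?thesis by blast
qed

lemma snd_finite_subgroup_p2gg_C4:
  assumes "S \<in> finite_subgroups p2gg_C4"
  shows "snd ` S \<subseteq> C4_H"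
proof
  fix c assume "c \<in> snd ` S"
  then obtain g where g: "g \<in> S" "c = snd g" by blast
  then have gc: "g \<in> carrier p2gg_C4"
    using finite_subgroups_carrier[OF assms] by blast
  obtain x y where xy: "fst g (x, y) = (x, y)"
  proof -
    obtain z where "z \<in> fixed_points euclidean fst S"
      using fixed_points_p2gg_C4_nonempty[OF assms] by blast
    then have "fst g z = z" using g(1) unfolding fixed_points_def by blast
    then show ?thesis using that by (cases z) blast
  qed
  from gc show "c \<in> C4_H"
  proof (rule p2gg_C4_cases)
    fix s t a b d assume h: "g = (sgn_affine (s, t, a, b), d)" "(s, t, a, b) \<in> sgn_affine_par"
      "d \<in> {0, 1, 2, 3}" "s = t \<longleftrightarrow> d \<in> {0, 2}"
    have "s = t"
    proof (rule ccontr)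
      assume "s \<noteq> t"
      \<comment> \<open>One of the signs is 1, and in that coordinate the map is translation by an
        odd, hence nonzero, integer.\<close>
      then have "odd a" "odd b" "s = 1 \<or> t = 1" using h(2) by (auto simp: sgn_affine_par_def)
      moreover have "s * x + of_int a = x" "t * y + of_int b = y"
        using xy h(1) by (simp_all add: sgn_affine_def)
      ultimately show False by auto
    qed
    then show "c \<in> C4_H" using h g by (simp add: C4_H_def)
  qed
qed

lemma model_for_EG_p2gg_C4: "model_for_EG p2gg_C4 euclidean fst"
  unfolding model_for_EG_def
proof (intro conjI ballI)
  fix S assume S: "S \<in> finite_subgroups p2gg_C4"
  have "convex (fixed_points euclidean fst S)"
  proof (rule convexI)
    fix x y and u v :: real
    assume xy: "x \<in> fixed_points euclidean fst S" "y \<in> fixed_points euclidean fst S" "u + v = 1"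
    have "fst g (u *\<^sub>R x + v *\<^sub>R y) = u *\<^sub>R x + v *\<^sub>R y" if g: "g \<in> S" for g
    proof -
      have "fst g x = x" "fst g y = y" using xy(1,2) g unfolding fixed_points_def by blast+
      then show ?thesis using p2gg_C4_affine[OF finite_subgroups_carrier[OF S g] xy(3)] by simp
    qed
    then show "u *\<^sub>R x + v *\<^sub>R y \<in> fixed_points euclidean fst S"
      unfolding fixed_points_def by simp
  qed
  then show "contractible_space (subtopology euclidean (fixed_points euclidean fst S))"
    by (simp add: convex_imp_contractible)
qed (simp_all only: G_CW_complex_p2gg_C4 finite_stabilizer_p2gg_C4 fixed_points_p2gg_C4_nonempty
    not_False_eq_True)

section \<open>Cocompactness\<close>

lemma compact_orbit_space:
  assumes "group_action G (topspace X) \<phi>" "compactin X K"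
    and K: "\<And>x. x \<in> topspace X \<Longrightarrow> \<exists>z\<in>K. \<exists>g\<in>carrier G. x = \<phi> g z"
  shows "compact_space (orbit_space G X \<phi>)"
proof -
  interpret group_action G "topspace X" \<phi> by fact
  have "openin (orbit_space G X \<phi>) (orbits G (topspace X) \<phi>)"
  proof -
    have "{x \<in> topspace X. orbit G \<phi> x \<in> orbits G (topspace X) \<phi>} = topspace X"
      by (auto simp: orbits_def)
    then show ?thesis unfolding openin_orbit_space by simp
  qed
  then have top: "topspace (orbit_space G X \<phi>) = orbits G (topspace X) \<phi>"
    by (metis openin_orbit_space openin_subset openin_topspace subset_antisym)
  have cont: "continuous_map X (orbit_space G X \<phi>) (orbit G \<phi>)"
    unfolding continuous_map_def top openin_orbit_space by (auto simp: orbits_def)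
  have "orbit G \<phi> ` K = orbits G (topspace X) \<phi>"
  proof (intro equalityI subsetI)
    fix c assume "c \<in> orbits G (topspace X) \<phi>"
    then obtain x where x: "x \<in> topspace X" "c = orbit G \<phi> x" by (auto simp: orbits_def)
    then obtain z g where z: "z \<in> K" "g \<in> carrier G" "x = \<phi> g z" using K by blast
    have zX: "z \<in> topspace X" using z(1) assms(2) compactin_subset_topspace by blast
    have "x \<in> orbit G \<phi> z" using z by (auto simp: orbit_def)
    moreover have "x \<in> orbit G \<phi> x" using x(1) by (rule orbit_refl)
    moreover have "orbit G \<phi> z \<in> orbits G (topspace X) \<phi>" "orbit G \<phi> x \<in> orbits G (topspace X) \<phi>"
      using x zX by (auto simp: orbits_def)
    ultimately have "orbit G \<phi> x = orbit G \<phi> z" using disjoint_union by blast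
    then show "c \<in> orbit G \<phi> ` K" using z(1) x(2) by blast
  qed (use compactin_subset_topspace[OF assms(2)] in \<open>auto simp: orbits_def\<close>)
  then show ?thesis
    using image_compactin[OF assms(2) cont] by (simp add: compact_space_def top)
qed

lemma cocompact_model_for_EG_p2gg_C4: "cocompact_model_for_EG p2gg_C4 euclidean fst"
  unfolding cocompact_model_for_EG_def
proof (intro conjI model_for_EG_p2gg_C4 compact_orbit_space[where K = "{0..2} \<times> {0..2}"])
  show "group_action p2gg_C4 (topspace euclidean) fst" by (simp add: group_action_p2gg_C4)
  show "compactin euclidean ({0..2} \<times> {0..2} :: (real \<times> real) set)" by (simp add: compact_Times)
  fix x :: "real \<times> real"
  let ?m = "\<lfloor>fst x / 2\<rfloor>" and ?n = "\<lfloor>snd x / 2\<rfloor>"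
  have "\<exists>g\<in>carrier p2gg_C4. \<exists>z\<in>{0..2} \<times> {0..2}. (fst x, snd x) = fst g z"
  \<comment> \<open>Translations by even integers suffice: subtracting twice the floor of half a
    coordinate leaves a remainder between 0 and 2.\<close>
  proof (rule p2gg_C4_moveI[of 1 1 "2 * ?m" "2 * ?n" _ "fst x - 2 * ?m" _ "snd x - 2 * ?n"])
    have "0 \<le> r - 2 * \<lfloor>r / 2\<rfloor>" "r - 2 * \<lfloor>r / 2\<rfloor> \<le> 2" for r :: real by linarith+
    then show "(fst x - 2 * ?m, snd x - 2 * ?n) \<in> {0..2} \<times> {0..2}" by simp
  qed (simp_all add: sgn_affine_par_def)
  then show "\<exists>z\<in>{0..2} \<times> {0..2}. \<exists>g\<in>carrier p2gg_C4. x = fst g z" by auto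
qed

section \<open>Compatibility of the sign collection\<close>

lemma group_orthogonal_grp: "group (orthogonal_grp :: (real^'n^'n) monoid)"
proof (rule groupI)
  fix A :: "real^'n^'n" assume "A \<in> carrier orthogonal_grp"
  then show "\<exists>B\<in>carrier orthogonal_grp. B \<otimes>\<^bsub>orthogonal_grp\<^esub> A = \<one>\<^bsub>orthogonal_grp\<^esub>"
    by (intro bexI[of _ "transpose A"]) (auto simp: orthogonal_grp_def orthogonal_matrix_def)
qed (auto simp: orthogonal_grp_def orthogonal_matrix_mul orthogonal_matrix_id matrix_mul_assoc)

lemma matrix_1_mult_commute: "A ** B = B ** (A :: real^1^1)"
  by (simp add: vec_eq_iff matrix_matrix_mult_def forall_1 mult.commute)

lemma sign_rep_hom:
  assumes "c \<in> C4_H" "d \<in> C4_H"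
  shows "sign_rep ((c + d) mod 4) = sign_rep c ** sign_rep d"
  using assms by (auto simp: C4_H_def sign_rep_def vec_eq_iff matrix_matrix_mult_def forall_1 mat_def)

lemma orthogonal_sign_rep: "orthogonal_matrix (sign_rep c)"
  by (auto simp: sign_rep_def orthogonal_matrix vec_eq_iff matrix_matrix_mult_def forall_1 mat_def transpose_def)

lemma sign_rep_snd_Hom:
  assumes "S \<in> finite_subgroups p2gg_C4"
  shows "restrict (sign_rep \<circ> snd) S \<in> Hom_from_subgroup p2gg_C4 S orthogonal_grp"
proof -
  interpret S: subgroup S p2gg_C4 using finite_subgroupsD[OF assms] by blast
  have "restrict (sign_rep \<circ> snd) S \<in> hom (p2gg_C4\<lparr>carrier := S\<rparr>) orthogonal_grp"
  proof (rule homI)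
    fix x y assume "x \<in> carrier (p2gg_C4\<lparr>carrier := S\<rparr>)" "y \<in> carrier (p2gg_C4\<lparr>carrier := S\<rparr>)"
    then have xy: "x \<in> S" "y \<in> S" by simp_all
    have c: "snd x \<in> C4_H" "snd y \<in> C4_H" using snd_finite_subgroup_p2gg_C4[OF assms] xy by blast+
    have "snd (x \<otimes>\<^bsub>p2gg_C4\<^esub> y) = (snd x + snd y) mod 4" by (simp add: p2gg_C4_mult)
    then show "restrict (sign_rep \<circ> snd) S (x \<otimes>\<^bsub>p2gg_C4\<lparr>carrier := S\<rparr>\<^esub> y) =
        restrict (sign_rep \<circ> snd) S x \<otimes>\<^bsub>orthogonal_grp\<^esub> restrict (sign_rep \<circ> snd) S y"
      using xy sign_rep_hom[OF c] by (simp add: orthogonal_grp_def)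
  qed (simp add: orthogonal_grp_def orthogonal_sign_rep)
  then show ?thesis by (simp add: Hom_from_subgroup_def)
qed

lemma inner_conj_rel_self:
  assumes "\<alpha> \<in> Hom_from_subgroup G S K" "group K"
  shows "(\<alpha>, \<alpha>) \<in> inner_conj_rel G S K"
proof -
  interpret K: group K by fact
  have "\<alpha> s \<in> carrier K" if "s \<in> S" for s
    using assms(1) that by (auto simp: Hom_from_subgroup_def hom_def)
  then show ?thesis
    using assms(1) unfolding inner_conj_rel_def by (auto intro!: bexI[of _ "\<one>\<^bsub>K\<^esub>"])
qed

text \<open>Matrices of size one commute, so conjugation is trivial and each class contains a single
  homomorphism.\<close>

lemma inner_conj_rel_one_dim:
  fixes \<alpha> \<beta> :: "'g \<Rightarrow> real^1^1"
  assumes "(\<alpha>, \<beta>) \<in> inner_conj_rel G S orthogonal_grp" "s \<in> S"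
  shows "\<beta> s = \<alpha> s"
proof -
  interpret O: group "orthogonal_grp :: (real^1^1) monoid" by (rule group_orthogonal_grp)
  obtain k where k: "k \<in> carrier (orthogonal_grp :: (real^1^1) monoid)"
    "\<beta> s = k \<otimes>\<^bsub>orthogonal_grp\<^esub> \<alpha> s \<otimes>\<^bsub>orthogonal_grp\<^esub> inv\<^bsub>orthogonal_grp\<^esub> k"
    using assms by (auto simp: inner_conj_rel_def)
  define k' where "k' = inv\<^bsub>orthogonal_grp\<^esub> k"
  have "k ** k' = mat 1" "\<beta> s = k ** \<alpha> s ** k'"
    using O.r_inv[OF k(1)] k(2) unfolding k'_def[symmetric] by (simp_all add: orthogonal_grp_def)
  moreover have "k ** \<alpha> s ** k' = \<alpha> s ** (k ** k')"
    by (subst matrix_1_mult_commute[of k]) (simp only: matrix_mul_assoc)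
  ultimately show ?thesis by simp
qed

text \<open>A map of orbits with \<open>f S = g T\<close> gives for each \<open>s\<close> in
  \<open>S\<close> an element \<open>t\<close> of \<open>T\<close> with \<open>s g = g t\<close>. As
  C4 is abelian, \<open>s\<close> and \<open>t\<close> have the same second component, so
  conjugation by \<open>g\<close> leaves the sign unchanged.\<close>

lemma sign_collection_compatible:
  "(\<lambda>S\<in>finite_subgroups p2gg_C4. inner_conj_rel p2gg_C4 S orthogonal_grp `` {restrict (sign_rep \<circ> snd) S})
    \<in> compatible_collections p2gg_C4 orthogonal_grp"
  (is "?A \<in> _")
  unfolding compatible_collections_def
proof (intro CollectI conjI ballI impI)
  show "?A \<in> (\<Pi>\<^sub>E S\<in>finite_subgroups p2gg_C4.
      Hom_from_subgroup p2gg_C4 S orthogonal_grp // inner_conj_rel p2gg_C4 S orthogonal_grp)"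
    using sign_rep_snd_Hom by (auto intro!: quotientI)
next
  interpret G: group p2gg_C4 by (rule group_p2gg_C4)
  fix S T f \<alpha> g
  assume S: "S \<in> finite_subgroups p2gg_C4" and T: "T \<in> finite_subgroups p2gg_C4"
    and f: "f \<in> G_maps p2gg_C4 S T" and \<alpha>: "\<alpha> \<in> ?A T"
    and g: "g \<in> carrier p2gg_C4" and fS: "f S = g <#\<^bsub>p2gg_C4\<^esub> T"
  interpret S: subgroup S p2gg_C4 using finite_subgroupsD[OF S] by blast
  interpret T: subgroup T p2gg_C4 using finite_subgroupsD[OF T] by blast
  have \<alpha>': "\<alpha> t = sign_rep (snd t)" if "t \<in> T" for t
    using \<alpha> T inner_conj_rel_one_dim[of _ \<alpha> p2gg_C4 T t] that by auto
  have eq: "\<alpha> (inv\<^bsub>p2gg_C4\<^esub> g \<otimes>\<^bsub>p2gg_C4\<^esub> s \<otimes>\<^bsub>p2gg_C4\<^esub> g) = sign_rep (snd s)" if s: "s \<in> S" for s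
  proof -
    \<comment> \<open>The coset \<open>S\<close> is fixed by \<open>s\<close>; by equivariance so is
      its image \<open>g T\<close>.\<close>
    have "S = \<one>\<^bsub>p2gg_C4\<^esub> <#\<^bsub>p2gg_C4\<^esub> S" by (simp add: G.lcos_mult_one S.subset)
    then have "S \<in> lcosets\<^bsub>p2gg_C4\<^esub> S" unfolding LCOSETS_def using G.one_closed by blast
    then have "f (s <#\<^bsub>p2gg_C4\<^esub> S) = s <#\<^bsub>p2gg_C4\<^esub> f S" using f s by (simp add: G_maps_def)
    moreover have "s <#\<^bsub>p2gg_C4\<^esub> S = S"
      using s by (intro G.coset_join3 S.subgroup_axioms) auto
    ultimately have "s <#\<^bsub>p2gg_C4\<^esub> (g <#\<^bsub>p2gg_C4\<^esub> T) = g <#\<^bsub>p2gg_C4\<^esub> T" using fS by simp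
    moreover have "g \<in> g <#\<^bsub>p2gg_C4\<^esub> T" using G.lcos_self[OF g T.subgroup_axioms] .
    ultimately have "s \<otimes>\<^bsub>p2gg_C4\<^esub> g \<in> g <#\<^bsub>p2gg_C4\<^esub> T" unfolding l_coset_def by blast
    then obtain t where t: "t \<in> T" "s \<otimes>\<^bsub>p2gg_C4\<^esub> g = g \<otimes>\<^bsub>p2gg_C4\<^esub> t" by (auto simp: l_coset_def)
    have "inv\<^bsub>p2gg_C4\<^esub> g \<otimes>\<^bsub>p2gg_C4\<^esub> s \<otimes>\<^bsub>p2gg_C4\<^esub> g = inv\<^bsub>p2gg_C4\<^esub> g \<otimes>\<^bsub>p2gg_C4\<^esub> (g \<otimes>\<^bsub>p2gg_C4\<^esub> t)"
      using g s by (simp add: G.m_assoc t(2)[symmetric])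
    also have "\<dots> = t" using g t(1) by (simp add: G.m_assoc[symmetric])
    finally have "\<alpha> (inv\<^bsub>p2gg_C4\<^esub> g \<otimes>\<^bsub>p2gg_C4\<^esub> s \<otimes>\<^bsub>p2gg_C4\<^esub> g) = sign_rep (snd t)"
      using \<alpha>'[OF t(1)] by simp
    moreover have "snd t = snd s"
    proof -
      have "(snd s + snd g) mod 4 = (snd g + snd t) mod 4"
        using arg_cong[OF t(2), of snd] by (simp add: p2gg_C4_mult)
      moreover have "snd s \<in> {0, 2}" "snd t \<in> {0, 2}"
        using snd_finite_subgroup_p2gg_C4[OF S] snd_finite_subgroup_p2gg_C4[OF T] s t(1)
        by (auto simp: C4_H_def)
      ultimately show ?thesis by (auto; presburger)
    qed
    ultimately show ?thesis by simp
  qed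
  have "(\<lambda>s\<in>S. \<alpha> (inv\<^bsub>p2gg_C4\<^esub> g \<otimes>\<^bsub>p2gg_C4\<^esub> s \<otimes>\<^bsub>p2gg_C4\<^esub> g)) = restrict (sign_rep \<circ> snd) S"
    using eq by (intro restrict_ext) simp
  then show "(\<lambda>s\<in>S. \<alpha> (inv\<^bsub>p2gg_C4\<^esub> g \<otimes>\<^bsub>p2gg_C4\<^esub> s \<otimes>\<^bsub>p2gg_C4\<^esub> g)) \<in> ?A S"
    using S inner_conj_rel_self[OF sign_rep_snd_Hom[OF S] group_orthogonal_grp] by simp
qed

section \<open>The sign collection is not realized\<close>

text \<open>These are the elements with prescribed sign: the half turn about an integer point,
  lifted with component 0, and the generator of the kernel of the action.\<close>

lemma integer_points_stabilizer:
  "(sgn_affine (-1, -1, 2 * i, 2 * j), 0) \<in> stabilizer p2gg_C4 fst (of_int i, of_int j)"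
  "(id, 2) \<in> stabilizer p2gg_C4 fst x"
proof -
  have "id = sgn_affine (1, 1, 0, 0)" by (rule ext) (auto simp: sgn_affine_def)
  moreover have "(sgn_affine (1, 1, 0, 0), 2) \<in> carrier p2gg_C4"
    by (simp add: sgn_affine_in_p2gg_C4 sgn_affine_par_def)
  ultimately show "(id, 2) \<in> stabilizer p2gg_C4 fst x"
    by (simp add: stabilizer_def)
  have "(sgn_affine (-1, -1, 2 * i, 2 * j), 0) \<in> carrier p2gg_C4"
    by (simp add: sgn_affine_in_p2gg_C4 sgn_affine_par_def)
  then show "(sgn_affine (-1, -1, 2 * i, 2 * j), 0) \<in> stabilizer p2gg_C4 fst (of_int i, of_int j)"
    by (simp add: stabilizer_def sgn_affine_def)
qed

text \<open>The sign \<open>s x\<close> orients the fibre over \<open>x\<close>, and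
  \<open>w g x\<close> records whether \<open>g\<close> carries the orientation at \<open>x\<close>
  to the one at its image. A relation in the group, evaluated at (0, 0) with the cocycle rule, then
  forces a product of signs to equal its negative.\<close>

lemma no_p2gg_C4_line_bundle:
  fixes E :: "('e, real \<times> real) vbundle"
  assumes E: "G_vector_bundle p2gg_C4 euclidean fst E \<psi>"
    and rep: "\<And>x. \<exists>\<alpha> :: _ \<Rightarrow> real^1^1. fibre_rep_iso (stabilizer p2gg_C4 fst x) \<alpha> E \<psi> x \<and>
        (\<forall>s\<in>stabilizer p2gg_C4 fst x. \<alpha> s $ 1 $ 1 = (if snd s = 0 then 1 else - 1))"
  shows False
proof -
  obtain U a m where U: "\<And>y :: real \<times> real. open (U y)" "\<And>y. y \<in> U y"
    and a0: "\<And>y x. x \<in> U y \<Longrightarrow> a y x \<noteq> (0::real)"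
    and m_mult: "\<And>g h x. g \<in> carrier p2gg_C4 \<Longrightarrow> h \<in> carrier p2gg_C4 \<Longrightarrow>
       m (g \<otimes>\<^bsub>p2gg_C4\<^esub> h) x = m g (fst h x) * m h x"
    and m_stab: "\<And>g x. g \<in> stabilizer p2gg_C4 fst x \<Longrightarrow> m g x = (if snd g = 0 then 1 else - 1)"
    and cont: "\<And>g y z. g \<in> carrier p2gg_C4 \<Longrightarrow>
       continuous_on {x \<in> U y. fst g x \<in> U z} (\<lambda>x. a y x * m g x / a z (fst g x))"
  proof (rule G_line_bundle_cocycle[OF E group_action_p2gg_C4 rep])
  qed (rule that)
  interpret group_action p2gg_C4 UNIV fst by (rule group_action_p2gg_C4)
  interpret G: group p2gg_C4 by (rule group_p2gg_C4)
  have m_one: "m \<one>\<^bsub>p2gg_C4\<^esub> x = 1" for x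
    using m_stab[OF stabilizer_one_closed[of x]] by (simp add: p2gg_C4_one)
  have m0: "m g x \<noteq> 0" if "g \<in> carrier p2gg_C4" for g x
    using m_mult[OF G.inv_closed[OF that] that, of x] m_one[of x] G.l_inv[OF that] by auto
  \<comment> \<open>All factors are nonzero, so \<open>sgn\<close> is continuous there; it also
    discards the magnitudes of the arbitrary basis vectors and turns the quotient into a
    product.\<close>
  have sgn_cont: "continuous_on {x \<in> U y. fst g x \<in> U z}
      (\<lambda>x. sgn (a y x) * sgn (m g x) * sgn (a z (fst g x)))" if "g \<in> carrier p2gg_C4" for g y z
  proof -
    have "continuous_on {x \<in> U y. fst g x \<in> U z} (\<lambda>x. sgn (a y x * m g x / a z (fst g x)))"
      using a0 m0[OF that] by (intro continuous_on_sgn cont that) auto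
    moreover have "sgn (a y x * m g x / a z (fst g x)) =
        sgn (a y x) * sgn (m g x) * sgn (a z (fst g x))" for x
      by (simp add: sgn_mult divide_inverse)
    ultimately show ?thesis by (simp only:)
  qed
  \<comment> \<open>The box contains the unit square and its image under the glide reflection, and
    also the segment from (0, 0) to (0, 2) that the half turn about (0, 1) reverses.\<close>
  let ?K = "{0..1::real} \<times> {0..2::real}"
  have "orientable_on UNIV U (\<lambda>y x. sgn (a y x)) ?K"
  proof (rule orientable_on_box)
    show "sgn (a y x) \<in> {1, - 1}" if "x \<in> U y" for x y
      using a0[OF that] by (auto simp: sgn_if)
    have "{x \<in> U y. x \<in> U z} = U y \<inter> U z" for y z by blast
    then show "continuous_on (U y \<inter> U z) (\<lambda>x. sgn (a y x) * sgn (a z x))" for y z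
      using sgn_cont[OF G.one_closed, of y z] m_one by (simp add: p2gg_C4_one)
  qed (use U in auto)
  then obtain s where s: "\<And>x. s x \<in> {1, - 1 :: real}"
    and s_cont: "\<And>y. continuous_on (?K \<inter> U y) (\<lambda>x. s x * sgn (a y x))"
    unfolding orientable_on_def by auto
  have s2: "s x * s x = 1" for x using s[of x] by auto
  define w where "w g x = s x * sgn (m g x) * s (fst g x)" for g x
  have w_const: "w g x = w g y"
    if g: "g \<in> carrier p2gg_C4" and C: "connected C" "C \<subseteq> ?K" "fst g ` C \<subseteq> ?K" "x \<in> C" "y \<in> C" for g C x y
  proof -
    have g_cont: "continuous_on A (fst g)" for A
      using g by (rule p2gg_C4_cases)
        (auto simp: sgn_affine_def case_prod_unfold intro!: continuous_intros)
    have "continuous_on C (w g)"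
    proof (rule continuous_on_open_nbhds)
      fix x :: "real \<times> real" assume "x \<in> C"
      let ?y = "fst g x"
      let ?V = "{z. fst g z \<in> U ?y} \<inter> U x" and ?S = "C \<inter> ({z. fst g z \<in> U (fst g x)} \<inter> U x)"
      have "open ?V"
        using open_vimage[OF U(1) g_cont, of ?y] U(1) by (intro open_Int) (simp_all add: vimage_def)
      moreover have "x \<in> ?V" using U(2) by simp
      moreover have "continuous_on ?S (w g)"
      proof -
        \<comment> \<open>Inserting squares of the signs of the two local sections, which equal 1,
          splits \<open>w g\<close> into three factors known to be continuous.\<close>
        have "continuous_on ?S (\<lambda>z. (s z * sgn (a x z)) *
            (sgn (a x z) * sgn (m g z) * sgn (a ?y (fst g z))) * (s (fst g z) * sgn (a ?y (fst g z))))"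
        proof (rule continuous_on_mult, rule continuous_on_mult)
          show "continuous_on ?S (\<lambda>z. s z * sgn (a x z))"
            by (rule continuous_on_subset[OF s_cont]) (use C(2) in auto)
          show "continuous_on ?S (\<lambda>z. sgn (a x z) * sgn (m g z) * sgn (a ?y (fst g z)))"
            by (rule continuous_on_subset[OF sgn_cont[OF g]]) auto
          show "continuous_on ?S (\<lambda>z. s (fst g z) * sgn (a ?y (fst g z)))"
            by (rule continuous_on_compose2[OF s_cont g_cont]) (use C(3) in auto)
        qed
        then show ?thesis
        proof (rule continuous_on_eq)
          fix z assume "z \<in> ?S"
          then have "sgn (a x z) * sgn (a x z) = 1" "sgn (a ?y (fst g z)) * sgn (a ?y (fst g z)) = 1"
            using a0 by (auto simp: sgn_if)
          then show "(s z * sgn (a x z)) * (sgn (a x z) * sgn (m g z) * sgn (a ?y (fst g z))) *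
              (s (fst g z) * sgn (a ?y (fst g z))) = w g z"
            unfolding w_def by algebra
        qed
      qed
      ultimately show "\<exists>V. open V \<and> x \<in> V \<and> continuous_on (C \<inter> V) (w g)" by blast
    qed
    moreover have "finite (w g ` C)"
    proof (rule finite_subset)
      have "w g x \<in> {1, - 1}" for x
        using s[of x] s[of "fst g x"] m0[OF g, of x] by (auto simp: w_def sgn_if)
      then show "w g ` C \<subseteq> {1, - 1}" by blast
    qed simp
    ultimately have "w g constant_on C"
      using C(1) by (intro continuous_finite_range_constant)
    then show ?thesis using C(4,5) unfolding constant_on_def by metis
  qed
  \<comment> \<open>The lifts of this glide reflection have component 1 or 3; doubling either gives
    2 modulo 4.\<close>
  define g where "g = (sgn_affine (-1, 1, 1, 1), 1 :: int)"
  let ?\<rho> = "\<lambda>j. (sgn_affine (-1, -1, 0, 2 * j), 0 :: int)"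
  let ?z = "(id, 2 :: int)"
  have g: "g \<in> carrier p2gg_C4"
    by (simp add: g_def sgn_affine_in_p2gg_C4 sgn_affine_par_def)
  have \<rho>_stab: "?\<rho> j \<in> stabilizer p2gg_C4 fst (0, of_int j)" for j
    using integer_points_stabilizer(1)[of 0 j] by simp
  have z_stab: "?z \<in> stabilizer p2gg_C4 fst x" for x by (rule integer_points_stabilizer)
  have \<rho>: "?\<rho> j \<in> carrier p2gg_C4" and z: "?z \<in> carrier p2gg_C4" for j
    using \<rho>_stab z_stab stabilizer_subset by blast+
  have g_app: "fst g (x, y) = (1 - x, y + 1)" for x y
    by (simp add: g_def sgn_affine_def)
  have "w g (0, 0) = w g (1, 1)"
    by (rule w_const[where C = "{0..1} \<times> {0..1}", OF g]) (auto intro!: connected_Times simp: g_app)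
  \<comment> \<open>In the product of the equal values of \<open>w g\<close> at (0, 0) and (1, 1)
    the sign \<open>s (1, 1)\<close> cancels, leaving the ends of the chain (0, 0), (1, 1), (0,
    2).\<close>
  then have 1: "sgn (m g (1, 1) * m g (0, 0)) = s (0, 0) * s (0, 2)"
    using s[of "(0, 0)"] s[of "(1, 1)"] s[of "(0, 2)"] m0[OF g, of "(0, 0)"] m0[OF g, of "(1, 1)"]
    unfolding sgn_mult w_def g_app by (auto simp: sgn_if split: if_splits)
  \<comment> \<open>The half turn about (0, 1) swaps (0, 0) and (0, 2). At its fixed point the
    orientation signs cancel and leave the prescribed value 1, which constancy carries to (0,
    0).\<close>
  have "w (?\<rho> 1) (0, 0) = w (?\<rho> 1) (0, 1)"
    by (rule w_const[where C = "{0} \<times> {0..2}", OF \<rho>]) (auto intro!: connected_Times simp: sgn_affine_def)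
  moreover have "m (?\<rho> 1) (0, 1) = 1" "m (?\<rho> 0) (0, 0) = 1"
    using m_stab[OF \<rho>_stab[of 1]] m_stab[OF \<rho>_stab[of 0]] by simp_all
  ultimately have 2: "sgn (m (?\<rho> 1) (0, 0)) = s (0, 0) * s (0, 2)" and 3: "m (?\<rho> 0) (0, 0) = 1"
    using s[of "(0, 0)"] s[of "(0, 2)"] s2[of "(0, 1)"] by (auto simp: w_def sgn_affine_def)
  \<comment> \<open>Half turns about (0, 0) and then (0, 1) compose to the translation by (0, 2);
    the central factor supplies the component 2.\<close>
  have "g \<otimes>\<^bsub>p2gg_C4\<^esub> g = ?\<rho> 1 \<otimes>\<^bsub>p2gg_C4\<^esub> (?\<rho> 0 \<otimes>\<^bsub>p2gg_C4\<^esub> ?z)"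
    by (auto simp: p2gg_C4_mult g_def sgn_affine_def fun_eq_iff)
  then have "m g (1, 1) * m g (0, 0) = m (?\<rho> 1) (0, 0) * (m (?\<rho> 0) (0, 0) * m ?z (0, 0))"
    using m_mult[OF g g, of "(0, 0)"] m_mult[OF \<rho>[of 0] z, of "(0, 0)"]
      m_mult[OF \<rho>[of 1] G.m_closed[OF \<rho>[of 0] z], of "(0, 0)"]
    by (simp add: g_app sgn_affine_def p2gg_C4_mult)
  moreover have "m ?z (0, 0) = - 1" using m_stab[OF z_stab] by simp
  ultimately have "sgn (m g (1, 1) * m g (0, 0)) = - (s (0, 0) * s (0, 2))"
    using 2 3 by (simp add: sgn_minus)
  then show False using 1 s[of "(0, 0)"] s[of "(0, 2)"] by auto
qed

text \<open>The realization condition is applied to each point together with its whole stabilizer,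
  which is a finite subgroup fixing that point.\<close>

lemma sign_collection_not_realized:
  fixes E :: "('e, real \<times> real) vbundle"
  shows "\<not> realizes p2gg_C4 euclidean fst E \<psi>
    (\<lambda>S\<in>finite_subgroups p2gg_C4. inner_conj_rel p2gg_C4 S orthogonal_grp `` {restrict (sign_rep \<circ> snd) S})"
  (is "\<not> realizes _ _ _ _ _ ?A")
proof
  assume R: "realizes p2gg_C4 euclidean fst E \<psi> ?A"
  interpret group_action p2gg_C4 UNIV fst by (rule group_action_p2gg_C4)
  show False
  proof (rule no_p2gg_C4_line_bundle)
    show "G_vector_bundle p2gg_C4 euclidean fst E \<psi>" using R by (simp add: realizes_def)
    fix x :: "real \<times> real"
    let ?S = "stabilizer p2gg_C4 fst x"
    have S: "?S \<in> finite_subgroups p2gg_C4"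
      using stabilizer_subgroup[of x] finite_stabilizer_p2gg_C4 by (simp add: finite_subgroups_def)
    have "x \<in> fixed_points euclidean fst ?S" by (simp add: fixed_points_def stabilizer_def)
    then obtain \<alpha> where \<alpha>: "\<alpha> \<in> ?A ?S" "fibre_rep_iso ?S \<alpha> E \<psi> x"
      using R S unfolding realizes_def by blast
    have "\<alpha> s = sign_rep (snd s)" if "s \<in> ?S" for s
      using \<alpha>(1) S inner_conj_rel_one_dim[of _ \<alpha> p2gg_C4 ?S s] that by auto
    then have "\<alpha> s $ 1 $ 1 = (if snd s = 0 then 1 else - 1)" if "s \<in> ?S" for s
      using that by (simp add: sign_rep_def mat_def)
    then show "\<exists>\<alpha> :: _ \<Rightarrow> real^1^1. fibre_rep_iso ?S \<alpha> E \<psi> x \<and>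
        (\<forall>s\<in>?S. \<alpha> s $ 1 $ 1 = (if snd s = 0 then 1 else - 1))"
      using \<alpha>(2) by blast
  qed
qed

theorem mainTheorem3:
  fixes \<iota> :: "(real \<times> real \<Rightarrow> real \<times> real) set \<Rightarrow> int" and \<kappa> :: "int set \<Rightarrow> int"
    and G :: "((real \<times> real \<Rightarrow> real \<times> real) \<times> int) monoid"
    and p :: "(real \<times> real \<Rightarrow> real \<times> real) \<times> int \<Rightarrow> int"
    and act :: "(real \<times> real \<Rightarrow> real \<times> real) \<times> int \<Rightarrow> real \<times> real \<Rightarrow> real \<times> real"
    and A :: "((real \<times> real \<Rightarrow> real \<times> real) \<times> int) set \<Rightarrow>
                ((real \<times> real \<Rightarrow> real \<times> real) \<times> int \<Rightarrow> real^1^1) set"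
  assumes "\<iota> \<in> iso (p2gg Mod p2gg_N) C2"
    and "\<kappa> \<in> iso (C4 Mod C4_H) C2"
    and "G = pullback_group p2gg C4 (\<lambda>\<gamma>. \<iota> (p2gg_N #>\<^bsub>p2gg\<^esub> \<gamma>)) (\<lambda>c. \<kappa> (C4_H #>\<^bsub>C4\<^esub> c))"
    and "p = snd"
    and "act = fst"
    and "A = (\<lambda>S\<in>finite_subgroups G. inner_conj_rel G S orthogonal_grp `` {restrict (sign_rep \<circ> p) S})"
  shows "cocompact_model_for_EG G euclidean act \<and>
         (\<forall>S\<in>finite_subgroups G. p ` S \<subseteq> C4_H) \<and>
         A \<in> compatible_collections G orthogonal_grp \<and>
         \<not> (\<exists>(E :: ('e, real \<times> real) vbundle) \<psi>. realizes G euclidean act E \<psi> A)"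
proof -
  have G: "G = p2gg_C4" using assms(1-3) pullback_group_eq_p2gg_C4 by simp
  have A: "A = (\<lambda>S\<in>finite_subgroups p2gg_C4.
      inner_conj_rel p2gg_C4 S orthogonal_grp `` {restrict (sign_rep \<circ> snd) S})"
    using assms(4,6) unfolding G by simp
  show ?thesis
    unfolding G A assms(4,5)
    using cocompact_model_for_EG_p2gg_C4 snd_finite_subgroup_p2gg_C4 sign_collection_compatible
      sign_collection_not_realized by blast
qed

end
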